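(* Consider $X=Y$. There is a key-agreement scheme that uses only one-way communication achieving the error-length pair $(0,\, H(X)-2)$.
   Context: Logarithms are base 2 and entropy is in bits. For $K\in\{0,1\}^*$ (finite bit sequences of any length), $|K|$ denotes its length, $K_n$ its $n$-th entry and $K^{n}=(K_1,\dots,K_n)$. A random $K\in\{0,1\}^*$ is a randomly-stopped bit sequence if $\mathbb{P}(K_n=k_n \mid |K|\ge n, K^{n-1}=k^{n-1})=1/2$ for all $n\ge 1$ and $k^n\in\{0,1\}^n$ with $\mathbb{P}(|K|\ge n, K^{n-1}=k^{n-1})>0$. $K$ is a conditionally randomly-stopped bit sequence given $W$ if $p_{K|W=w}$ is a randomly-stopped bit sequence distribution for every $w$ in the support of $W$. Key-agreement setting: $X,Y$ are correlated discrete random variables; Alice observes $X$, Bob observes $Y$; $G_A,G_B$ are local randomness with $(X,Y),G_A,G_B$ mutually independent. They alternate public messages $W_1$ (Alice, from $X,G_A$), $W_2$ (Bob, from $Y,G_B,W_1$), $W_3,\dots$ until stopping at time $N$; the scheme uses only one-way communication if $N=1$ always. Alice outputs $K_A$ (function of $X,G_A,W^N$), Bob outputs $K_B$ (function of $Y,G_B,W^N$). The scheme achieves the error-length pair $(\epsilon,\ell)$ if there exists a random $K\in\{0,1\}^*$ jointly distributed with all these variables such that: $K$ is a conditionally randomly-stopped bit sequence given $W^N$; $\mathbb{P}(K_A=K_B=K)\ge 1-\epsilon$; and $\mathbb{E}[|K|\cdot\mathbf{1}\{K_A=K_B=K\}]\ge \ell$. *)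

theory Defs
  imports "HOL-Probability.Probability"
begin

text \<open>Shannon entropy (base 2, in bits) of a discrete distribution, as an extended
  nonnegative real (it may be infinite). Terms with probability 0 contribute 0.\<close>
definition entropy_pmf :: "'a pmf \<Rightarrow> ennreal" where
  "entropy_pmf p = (\<integral>\<^sup>+ x. ennreal (pmf p x * log 2 (1 / pmf p x)) \<partial>count_space UNIV)"

text \<open>Randomly-stopped bit sequence distribution. Bits are indexed from 1:
  \<open>K_n = K ! (n-1)\<close>, \<open>K^n = take n K\<close>. For every n \<ge> 1 and every
  \<open>k^n\<close> (a list of length n) with \<open>P(|K| \<ge> n, K^{n-1} = k^{n-1}) > 0\<close>,
  \<open>P(K_n = k_n | |K| \<ge> n, K^{n-1} = k^{n-1}) = 1/2\<close>.\<close>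
definition randomly_stopped :: "bool list pmf \<Rightarrow> bool" where
  "randomly_stopped p \<longleftrightarrow>
     (\<forall>n \<ge> 1. \<forall>kn :: bool list. length kn = n \<longrightarrow>
        measure_pmf.prob p {K. n \<le> length K \<and> take (n - 1) K = take (n - 1) kn} > 0 \<longrightarrow>
        measure_pmf.prob p {K. n \<le> length K \<and> take (n - 1) K = take (n - 1) kn \<and> K ! (n - 1) = kn ! (n - 1)}
          / measure_pmf.prob p {K. n \<le> length K \<and> take (n - 1) K = take (n - 1) kn} = 1 / 2)"

text \<open>One-way key-agreement scheme achieving the error-length pair \<open>(\<epsilon>, \<ell>)\<close>
  for a joint source distribution \<open>PXY\<close> of \<open>(X,Y)\<close>.
  Alice observes \<open>X = fst\<close>, Bob observes \<open>Y = snd\<close>. Local randomness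
  \<open>G_A \<sim> GA\<close>, \<open>G_B \<sim> GB\<close> (discrete, valued in nat) independent of each other and
  of \<open>(X,Y)\<close>. The single public message is \<open>W_1 = W x ga\<close> (N = 1);
  the outputs are \<open>K_A = KA x ga W_1\<close>, \<open>K_B = KB y gb W_1\<close>.
  \<open>J\<close> is a joint distribution of \<open>((X,Y), G_A, G_B, K)\<close> whose marginal on
  \<open>((X,Y),G_A,G_B)\<close> is the product distribution; \<open>K\<close> must be conditionally
  randomly stopped given \<open>W_1\<close>, \<open>P(K_A = K_B = K) \<ge> 1 - \<epsilon>\<close>, and
  \<open>E[|K| 1{K_A = K_B = K}] \<ge> \<ell>\<close>.\<close>
definition one_way_achieves ::
  "('a \<times> 'b) pmf \<Rightarrow> real \<Rightarrow> ennreal \<Rightarrow> bool" where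
  "one_way_achieves PXY eps len \<longleftrightarrow>
     (\<exists>(GA :: nat pmf) (GB :: nat pmf)
        (W :: 'a \<Rightarrow> nat \<Rightarrow> bool list)
        (KA :: 'a \<Rightarrow> nat \<Rightarrow> bool list \<Rightarrow> bool list)
        (KB :: 'b \<Rightarrow> nat \<Rightarrow> bool list \<Rightarrow> bool list)
        (J :: (('a \<times> 'b) \<times> nat \<times> nat \<times> bool list) pmf).
        let Wof = (\<lambda>((x, y), ga, gb, k). W x ga);
            good = (\<lambda>((x, y), ga, gb, k).
                      KA x ga (W x ga) = k \<and> KB y gb (W x ga) = k)
        in
        map_pmf (\<lambda>(xy, ga, gb, k). (xy, ga, gb)) J = pair_pmf PXY (pair_pmf GA GB) \<and>
        (\<forall>w \<in> set_pmf (map_pmf Wof J).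
            randomly_stopped (map_pmf (\<lambda>(xy, ga, gb, k). k) (cond_pmf J {\<omega>. Wof \<omega> = w}))) \<and>
        measure_pmf.prob J {\<omega>. good \<omega>} \<ge> 1 - eps \<and>
        (\<integral>\<^sup>+ \<omega>. ennreal (real (length (snd (snd (snd \<omega>)))) * indicator {\<omega>. good \<omega>} \<omega>) \<partial>measure_pmf J) \<ge> len)"

end

theory Submission
  imports Defs "HOL-Library.Sublist"
begin

text \<open>
  A message splits the law of \<open>X\<close> into atoms \<open>m\<close>, nonnegative weights with a labelling \<open>f\<close> of the
  points by keys under which each next bit is fair. Such splittings can be rescaled and added, and
  two of them with equal mass and disjoint supports merge at a gain of one bit.

  For finite support, replace \<open>s log (1/s)\<close> by its chord on the dyadic interval containing \<open>s\<close>. The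
  resulting lower bound for the entropy is affine as long as no probability leaves its dyadic
  interval, so \<open>p\<close> may be moved along a line in both directions until at most one probability is not
  a power of 1/2. Then some set of points has probability exactly 1/2 (halve it, gaining one bit), or
  some point has probability at least 1/2 (balance part of it against the rest). The total
  loss against the entropy is at most 3/2. A law of finite entropy is truncated to a finite set, at
  an extra cost of 1/2.

  If the entropy is infinite, thin the points with \<open>2^-i \<le> p x \<le> 2^(1-i)\<close> to exactly \<open>2^-i\<close> each, and
  use a power of two of them as uniform key bits: the expected key length is then infinite.
\<close>

section \<open>Schemes from balanced atoms\<close>

text \<open>Fairness of the next bit stated without division: \<open>m\<close> may have any total
  mass, and at a \<open>v\<close> that no key extends both sides are 0, so atoms can be rescaled and
  cut without case distinctions.\<close>

definition balanced :: "'a set \<Rightarrow> ('a \<Rightarrow> real) \<Rightarrow> ('a \<Rightarrow> bool list) \<Rightarrow> bool" where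
  "balanced F m f \<longleftrightarrow>
     (\<forall>v. sum m {x \<in> F. prefix (v @ [False]) (f x)} = sum m {x \<in> F. prefix (v @ [True]) (f x)})"

lemma balanced_flip:
  assumes "balanced F m f"
  shows "sum m {x \<in> F. prefix (v @ [b]) (f x)} = sum m {x \<in> F. prefix (v @ [\<not> b]) (f x)}"
  using assms unfolding balanced_def by (cases b) auto

lemma prefix_snoc_iff_nth:
  "prefix (v @ [b]) K \<longleftrightarrow> length v < length K \<and> take (length v) K = v \<and> K ! length v = b"
proof
  assume "prefix (v @ [b]) K"
  then show "length v < length K \<and> take (length v) K = v \<and> K ! length v = b"
    by (auto simp: prefix_def nth_append)
next
  assume h: "length v < length K \<and> take (length v) K = v \<and> K ! length v = b"
  then have "take (Suc (length v)) K = v @ [b]"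
    by (simp add: take_Suc_conv_app_nth)
  then show "prefix (v @ [b]) K" by (metis take_is_prefix)
qed

text \<open>The conditioning event is the disjoint union of the extensions of \<open>v\<close> by
  either bit; if these are equally likely, each is half of it.\<close>

lemma randomly_stoppedI:
  assumes "\<And>v b. measure_pmf.prob r {K. prefix (v @ [b]) K} = measure_pmf.prob r {K. prefix (v @ [\<not> b]) K}"
  shows "randomly_stopped r"
  unfolding randomly_stopped_def
proof (intro allI impI)
  fix n :: nat and kn :: "bool list"
  assume n: "1 \<le> n" and len: "length kn = n"
    and pos: "0 < measure_pmf.prob r {K. n \<le> length K \<and> take (n - 1) K = take (n - 1) kn}"
  define v where "v = take (n - 1) kn"
  define b where "b = kn ! (n - 1)"
  have lv: "length v = n - 1" using n len by (simp add: v_def)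
  have num: "{K. n \<le> length K \<and> take (n - 1) K = take (n - 1) kn \<and> K ! (n - 1) = kn ! (n - 1)}
      = {K. prefix (v @ [b]) K}"
    unfolding prefix_snoc_iff_nth lv v_def[symmetric] b_def[symmetric] using n by auto
  have den: "{K. n \<le> length K \<and> take (n - 1) K = take (n - 1) kn}
      = {K. prefix (v @ [b]) K} \<union> {K. prefix (v @ [\<not> b]) K}"
    unfolding prefix_snoc_iff_nth lv v_def[symmetric] using n by auto
  have "measure_pmf.prob r ({K. prefix (v @ [b]) K} \<union> {K. prefix (v @ [\<not> b]) K})
      = measure_pmf.prob r {K. prefix (v @ [b]) K} + measure_pmf.prob r {K. prefix (v @ [\<not> b]) K}"
    by (rule measure_pmf.finite_measure_Union) (auto simp: prefix_snoc_iff_nth)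
  also have "\<dots> = 2 * measure_pmf.prob r {K. prefix (v @ [b]) K}"
    using assms[of v b] by simp
  finally show "measure_pmf.prob r {K. n \<le> length K \<and> take (n - 1) K = take (n - 1) kn \<and> K ! (n - 1) = kn ! (n - 1)}
      / measure_pmf.prob r {K. n \<le> length K \<and> take (n - 1) K = take (n - 1) kn} = 1 / 2"
    using pos unfolding num den by simp
qed

section \<open>From fair conditional key bits to a one-way scheme\<close>

lemma measure_cond_pmf:
  assumes "set_pmf p \<inter> S \<noteq> {}"
  shows "measure_pmf.prob (cond_pmf p S) A = measure_pmf.prob p (A \<inter> S) / measure_pmf.prob p S"
proof -
  have "measure_pmf.prob p S > 0"
    using assms by (simp add: measure_pmf_posI disjoint_iff) (meson measure_pmf_posI)
  then show ?thesis
    using assms by (simp add: cond_pmf.rep_eq measure_uniform_measure measure_pmf.emeasure_eq_measure Int_commute)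
qed

text \<open>The key is a function of the message and of \<open>X\<close>, so Bob, who sees the same
  \<open>X\<close>, always agrees with Alice. Conditioning on the message merely divides both sides
  of \<open>bal\<close> by its probability.\<close>

lemma one_way_achieves_nat_randomness:
  fixes PX :: "'a pmf" and GA :: "nat pmf" and W :: "'a \<Rightarrow> nat \<Rightarrow> nat"
    and f :: "nat \<Rightarrow> 'a \<Rightarrow> bool list"
  defines "M \<equiv> pair_pmf PX GA"
  assumes bal: "\<And>w v b. measure_pmf.prob M {(x, g). W x g = w \<and> prefix (v @ [b]) (f w x)}
      = measure_pmf.prob M {(x, g). W x g = w \<and> prefix (v @ [\<not> b]) (f w x)}"
    and len: "len \<le> (\<integral>\<^sup>+ (x, g). ennreal (real (length (f (W x g) x))) \<partial>measure_pmf M)"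
  shows "one_way_achieves (map_pmf (\<lambda>x. (x, x)) PX) 0 len"
proof -
  \<comment> \<open>Messages are sent in unary, so that \<open>length\<close> decodes them.\<close>
  define enc :: "nat \<Rightarrow> bool list" where "enc = (\<lambda>n. replicate n True)"
  have enc: "enc a = enc b \<longleftrightarrow> a = b" for a b by (auto simp: enc_def replicate_eq_replicate)
  define h where "h = (\<lambda>(x, g). ((x, x), g, 0 :: nat, f (W x g) x))"
  define J where "J = map_pmf h M"
  define Wof :: "('a \<times> 'a) \<times> nat \<times> nat \<times> bool list \<Rightarrow> bool list" where
    "Wof = (\<lambda>((x, y), ga, gb, k). enc (W x ga))"
  define good :: "('a \<times> 'a) \<times> nat \<times> nat \<times> bool list \<Rightarrow> bool" where
    "good = (\<lambda>((x, y), ga, gb, k). f (length (enc (W x ga))) x = k \<and> f (length (enc (W x ga))) y = k)"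
  have goodh: "good (h z)" for z by (cases z) (simp add: good_def h_def enc_def)
  have 1: "map_pmf (\<lambda>(xy, ga, gb, k). (xy, ga, gb)) J
      = pair_pmf (map_pmf (\<lambda>x. (x, x)) PX) (pair_pmf GA (return_pmf 0))"
    unfolding J_def h_def M_def pair_map_pmf1 pair_return_pmf2 pair_map_pmf2
    by (simp add: map_pmf_comp case_prod_unfold)
  have 2: "randomly_stopped (map_pmf (\<lambda>(xy, ga, gb, k). k) (cond_pmf J {\<omega>. Wof \<omega> = w}))"
    if w: "w \<in> set_pmf (map_pmf Wof J)" for w
  proof -
    obtain n where n: "w = enc n" using w by (auto simp: Wof_def)
    have ne: "set_pmf J \<inter> {\<omega>. Wof \<omega> = w} \<noteq> {}" using w by auto
    have *: "measure_pmf.prob (map_pmf (\<lambda>(xy, ga, gb, k). k) (cond_pmf J {\<omega>. Wof \<omega> = w})) {K. prefix u K}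
        = measure_pmf.prob M {(x, g). W x g = n \<and> prefix u (f n x)} / measure_pmf.prob J {\<omega>. Wof \<omega> = w}" for u
    proof -
      have "measure_pmf.prob (map_pmf (\<lambda>(xy, ga, gb, k). k) (cond_pmf J {\<omega>. Wof \<omega> = w})) {K. prefix u K}
        = measure_pmf.prob J (((\<lambda>(xy, ga, gb, k). k) -` {K. prefix u K}) \<inter> {\<omega>. Wof \<omega> = w}) / measure_pmf.prob J {\<omega>. Wof \<omega> = w}"
        by (simp add: measure_cond_pmf[OF ne])
      also have "measure_pmf.prob J (((\<lambda>(xy, ga, gb, k). k) -` {K. prefix u K}) \<inter> {\<omega>. Wof \<omega> = w})
        = measure_pmf.prob M {(x, g). W x g = n \<and> prefix u (f n x)}"
        unfolding J_def measure_map_pmf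
        by (rule arg_cong[where f = "measure_pmf.prob M"]) (auto simp: h_def Wof_def n enc)
      finally show ?thesis .
    qed
    show ?thesis by (rule randomly_stoppedI) (unfold *, rule arg_cong[where f = "\<lambda>t. t / _"], rule bal)
  qed
  have 3: "measure_pmf.prob J {\<omega>. good \<omega>} \<ge> 1 - 0"
    unfolding J_def measure_map_pmf using goodh by (simp add: vimage_def)
  have "(\<integral>\<^sup>+ \<omega>. ennreal (real (length (snd (snd (snd \<omega>)))) * indicator {\<omega>. good \<omega>} \<omega>) \<partial>measure_pmf J)
      = (\<integral>\<^sup>+ (x, g). ennreal (real (length (f (W x g) x))) \<partial>measure_pmf M)"
    unfolding J_def nn_integral_map_pmf
    by (rule nn_integral_cong) (simp add: goodh, simp add: h_def split: prod.splits)
  then have 4: "(\<integral>\<^sup>+ \<omega>. ennreal (real (length (snd (snd (snd \<omega>)))) * indicator {\<omega>. good \<omega>} \<omega>) \<partial>measure_pmf J) \<ge> len"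
    using len by simp
  show ?thesis
    unfolding one_way_achieves_def Let_def
    by (rule exI[of _ GA], rule exI[of _ "return_pmf 0"], rule exI[of _ "\<lambda>x g. enc (W x g)"],
        rule exI[of _ "\<lambda>x g w. f (length w) x"], rule exI[of _ "\<lambda>y g w. f (length w) y"], rule exI[of _ J],
        intro conjI ballI)
      (rule 1, erule 2[unfolded Wof_def], rule 3[unfolded good_def], rule 4[unfolded good_def])
qed

text \<open>A \<open>pmf\<close> has countable support, so its values can be coded by naturals. This
  admits function-valued local randomness in \<open>one_way_achieves_keyed\<close>.\<close>

lemma one_way_achieves_countable_randomness:
  fixes PX :: "'a pmf" and GA :: "'g pmf" and W :: "'a \<Rightarrow> 'g \<Rightarrow> nat"
    and f :: "nat \<Rightarrow> 'a \<Rightarrow> bool list"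
  defines "M \<equiv> pair_pmf PX GA"
  assumes bal: "\<And>w v b. measure_pmf.prob M {(x, g). W x g = w \<and> prefix (v @ [b]) (f w x)}
      = measure_pmf.prob M {(x, g). W x g = w \<and> prefix (v @ [\<not> b]) (f w x)}"
    and len: "len \<le> (\<integral>\<^sup>+ (x, g). ennreal (real (length (f (W x g) x))) \<partial>measure_pmf M)"
  shows "one_way_achieves (map_pmf (\<lambda>x. (x, x)) PX) 0 len"
proof -
  define c where "c = to_nat_on (set_pmf GA)"
  define d where "d = from_nat_into (set_pmf GA)"
  have "map_pmf (d \<circ> c) GA = map_pmf id GA"
    by (rule map_pmf_cong) (auto simp: c_def d_def)
  then have GA: "map_pmf d (map_pmf c GA) = GA"
    by (simp add: map_pmf_comp comp_def map_pmf_ident)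
  have M: "M = map_pmf (map_prod id d) (pair_pmf PX (map_pmf c GA))"
    unfolding M_def by (subst GA[symmetric]) (simp add: pair_map_pmf2 map_prod_def map_pmf_comp case_prod_unfold apsnd_def)
  show ?thesis
  proof (rule one_way_achieves_nat_randomness[of PX "map_pmf c GA" "\<lambda>x g. W x (d g)" f])
    fix w v b
    show "measure_pmf.prob (pair_pmf PX (map_pmf c GA)) {(x, g). W x (d g) = w \<and> prefix (v @ [b]) (f w x)}
      = measure_pmf.prob (pair_pmf PX (map_pmf c GA)) {(x, g). W x (d g) = w \<and> prefix (v @ [\<not> b]) (f w x)}"
      using bal[of w v b] unfolding M measure_map_pmf by (simp add: vimage_def case_prod_unfold)
    show "len \<le> (\<integral>\<^sup>+ (x, g). ennreal (real (length (f (W x (d g)) x))) \<partial>measure_pmf (pair_pmf PX (map_pmf c GA)))"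
      using len unfolding M nn_integral_map_pmf by (simp add: case_prod_unfold)
  qed
qed

lemma prob_pair_pmf_finite:
  assumes "finite F"
  shows "measure_pmf.prob (pair_pmf P Q) {(x, g). x \<in> F \<and> R x g}
    = (\<Sum>x\<in>F. pmf P x * measure_pmf.prob Q {g. R x g})"
proof -
  have "{(x, g). x \<in> F \<and> R x g} = (\<Union>x\<in>F. {x} \<times> {g. R x g})" by auto
  moreover have "measure_pmf.prob (pair_pmf P Q) (\<Union>x\<in>F. {x} \<times> {g. R x g})
      = (\<Sum>x\<in>F. measure_pmf.prob (pair_pmf P Q) ({x} \<times> {g. R x g}))"
    by (rule measure_pmf.finite_measure_finite_Union) (auto simp: assms disjoint_family_on_def)
  moreover have "measure_pmf.prob (pair_pmf P Q) ({x} \<times> {g. R x g}) = pmf P x * measure_pmf.prob Q {g. R x g}" for x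
  proof -
    have "measure_pmf.prob (pair_pmf P Q) ({x} \<times> {g. R x g})
        = measure_pmf.prob (pair_pmf P Q) ({x} \<times> {g. R x g} \<inter> set_pmf (pair_pmf P Q))"
      by (simp only: measure_Int_set_pmf)
    also have "{x} \<times> {g. R x g} \<inter> set_pmf (pair_pmf P Q) = ({x} \<inter> set_pmf P) \<times> ({g. R x g} \<inter> set_pmf Q)"
      by auto
    finally show ?thesis
      by (simp only: measure_pmf_prob_product countable_Int2 countable_set_pmf measure_Int_set_pmf pmf.rep_eq)
  qed
  ultimately show ?thesis by simp
qed

text \<open>The message names an atom, and \<open>m w x\<close> is the joint probability of
  \<open>X = x\<close> and message \<open>w\<close>. Points outside \<open>F w\<close> that send
  \<open>w\<close> get the empty key, which enters neither the balance nor the length.\<close>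

lemma one_way_achieves_atoms:
  fixes PX :: "'a pmf" and GA :: "'g pmf" and W :: "'a \<Rightarrow> 'g \<Rightarrow> nat"
    and F :: "nat \<Rightarrow> 'a set" and m :: "nat \<Rightarrow> 'a \<Rightarrow> real" and f :: "nat \<Rightarrow> 'a \<Rightarrow> bool list"
  assumes fin: "\<And>w. finite (F w)"
    and mass: "\<And>w x. x \<in> F w \<Longrightarrow> pmf PX x * measure_pmf.prob GA {g. W x g = w} = m w x"
    and nil: "\<And>w x. x \<notin> F w \<Longrightarrow> f w x = []"
    and bal: "\<And>w. balanced (F w) (m w) (f w)"
    and len: "len \<le> (\<Sum>w. ennreal (\<Sum>x\<in>F w. m w x * real (length (f w x))))"
  shows "one_way_achieves (map_pmf (\<lambda>x. (x, x)) PX) 0 len"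
proof (rule one_way_achieves_countable_randomness[of PX GA W f])
  let ?M = "pair_pmf PX GA"
  fix w v b
  have *: "measure_pmf.prob ?M {(x, g). W x g = w \<and> prefix (v @ [b]) (f w x)}
      = sum (m w) {x \<in> F w. prefix (v @ [b]) (f w x)}" for b
  proof -
    have "{(x, g). W x g = w \<and> prefix (v @ [b]) (f w x)}
        = {(x, g). x \<in> F w \<and> (W x g = w \<and> prefix (v @ [b]) (f w x))}"
      using nil by fastforce
    then have "measure_pmf.prob ?M {(x, g). W x g = w \<and> prefix (v @ [b]) (f w x)}
        = (\<Sum>x\<in>F w. pmf PX x * measure_pmf.prob GA {g. W x g = w \<and> prefix (v @ [b]) (f w x)})"
      by (simp only: prob_pair_pmf_finite[OF fin])
    also have "\<dots> = (\<Sum>x\<in>F w. if prefix (v @ [b]) (f w x) then m w x else 0)"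
      by (rule sum.cong) (auto simp: mass)
    also have "\<dots> = sum (m w) {x \<in> F w. prefix (v @ [b]) (f w x)}"
      using fin by (simp add: sum.inter_filter)
    finally show ?thesis .
  qed
  show "measure_pmf.prob ?M {(x, g). W x g = w \<and> prefix (v @ [b]) (f w x)}
      = measure_pmf.prob ?M {(x, g). W x g = w \<and> prefix (v @ [\<not> b]) (f w x)}"
    unfolding * by (rule balanced_flip[OF bal])
next
  let ?M = "pair_pmf PX GA"
  have "(\<integral>\<^sup>+ (x, g). ennreal (real (length (f (W x g) x))) \<partial>measure_pmf ?M)
      = (\<integral>\<^sup>+ z. (\<Sum>w. if w = W (fst z) (snd z) then ennreal (real (length (f w (fst z)))) else 0) \<partial>measure_pmf ?M)"
    by (rule nn_integral_cong) (simp add: sums_unique[OF sums_single, symmetric] split: prod.splits)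
  \<comment> \<open>The integral is decomposed by the message first, and below by the point of the
    finite set \<open>F w\<close>.\<close>
  also have "\<dots> = (\<Sum>w. \<integral>\<^sup>+ z. (if w = W (fst z) (snd z) then ennreal (real (length (f w (fst z)))) else 0) \<partial>measure_pmf ?M)"
    by (rule nn_integral_suminf) simp
  also have "\<dots> = (\<Sum>w. ennreal (\<Sum>x\<in>F w. m w x * real (length (f w x))))"
  proof (rule suminf_cong)
    fix w
    have "(\<integral>\<^sup>+ z. (if w = W (fst z) (snd z) then ennreal (real (length (f w (fst z)))) else 0) \<partial>measure_pmf ?M)
        = (\<integral>\<^sup>+ z. (\<Sum>x\<in>F w. ennreal (real (length (f w x))) * indicator {(y, g). y \<in> {x} \<and> W y g = w} z) \<partial>measure_pmf ?M)"
    proof (rule nn_integral_cong)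
      fix z :: "'a \<times> 'g"
      obtain y g where z: "z = (y, g)" by (cases z)
      have "(\<Sum>x\<in>F w. ennreal (real (length (f w x))) * indicator {(y, g). y \<in> {x} \<and> W y g = w} z)
          = (\<Sum>x\<in>F w. if x = y then (if w = W y g then ennreal (real (length (f w y))) else 0) else 0)"
        by (rule sum.cong) (auto simp: z)
      also have "\<dots> = (if w = W y g then ennreal (real (length (f w y))) else 0)"
        using fin nil[of y w] by (auto simp: sum.delta)
      finally show "(if w = W (fst z) (snd z) then ennreal (real (length (f w (fst z)))) else 0)
          = (\<Sum>x\<in>F w. ennreal (real (length (f w x))) * indicator {(y, g). y \<in> {x} \<and> W y g = w} z)"
        by (simp add: z)
    qed
    also have "\<dots> = (\<Sum>x\<in>F w. ennreal (real (length (f w x))) * emeasure (measure_pmf ?M) {(y, g). y \<in> {x} \<and> W y g = w})"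
      by (subst nn_integral_sum) (auto simp: nn_integral_cmult)
    also have "\<dots> = (\<Sum>x\<in>F w. ennreal (m w x * real (length (f w x))))"
    proof (rule sum.cong)
      fix x assume x: "x \<in> F w"
      have "measure_pmf.prob ?M {(y, g). y \<in> {x} \<and> W y g = w} = m w x"
        by (subst prob_pair_pmf_finite) (auto simp: mass[OF x])
      then show "ennreal (real (length (f w x))) * emeasure (measure_pmf ?M) {(y, g). y \<in> {x} \<and> W y g = w}
          = ennreal (m w x * real (length (f w x)))"
        by (simp add: measure_pmf.emeasure_eq_measure ennreal_mult'' mult.commute)
    qed simp
    also have "\<dots> = ennreal (\<Sum>x\<in>F w. m w x * real (length (f w x)))"
      by (rule sum_ennreal) (simp add: mass[symmetric])
    finally show "(\<integral>\<^sup>+ z. (if w = W (fst z) (snd z) then ennreal (real (length (f w (fst z)))) else 0) \<partial>measure_pmf ?M)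
        = ennreal (\<Sum>x\<in>F w. m w x * real (length (f w x)))" .
  qed
  finally show "len \<le> (\<integral>\<^sup>+ (x, g). ennreal (real (length (f (W x g) x))) \<partial>measure_pmf ?M)"
    using len by simp
qed

section \<open>Splitting a weight into balanced atoms\<close>

text \<open>Masses stay unnormalised and \<open>l\<close> counts mass times bits, so that
  \<open>p\<close> and \<open>l\<close> scale and add together.\<close>

definition keyed :: "'a set \<Rightarrow> ('a \<Rightarrow> real) \<Rightarrow> real \<Rightarrow> bool" where
  "keyed F p l \<longleftrightarrow> (\<exists>(I :: nat set) m f. finite I \<and>
     (\<forall>i\<in>I. (\<forall>x\<in>F. 0 \<le> m i x) \<and> balanced F (m i) (f i)) \<and>
     (\<forall>x\<in>F. (\<Sum>i\<in>I. m i x) = p x) \<and>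
     l \<le> (\<Sum>i\<in>I. \<Sum>x\<in>F. m i x * real (length (f i x))))"

text \<open>Allows index sets of any type, since sums and products of index sets arise
  below.\<close>

lemma keyedI:
  fixes I :: "'i set"
  assumes I: "finite I"
    and nn: "\<And>i x. i \<in> I \<Longrightarrow> x \<in> F \<Longrightarrow> 0 \<le> m i x"
    and bal: "\<And>i. i \<in> I \<Longrightarrow> balanced F (m i) (f i)"
    and p: "\<And>x. x \<in> F \<Longrightarrow> (\<Sum>i\<in>I. m i x) = p x"
    and l: "l \<le> (\<Sum>i\<in>I. \<Sum>x\<in>F. m i x * real (length (f i x)))"
  shows "keyed F p l"
proof -
  obtain h where h: "bij_betw h {0..<card I} I"
    using ex_bij_betw_nat_finite[OF I] by auto
  have hI: "h i \<in> I" if "i < card I" for i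
    using h that by (auto simp: bij_betw_def)
  have p': "(\<Sum>i\<in>{0..<card I}. m (h i) x) = p x" if "x \<in> F" for x
    using sum.reindex_bij_betw[OF h, of "\<lambda>i. m i x"] p[OF that] by simp
  have l': "l \<le> (\<Sum>i\<in>{0..<card I}. \<Sum>x\<in>F. m (h i) x * real (length (f (h i) x)))"
    using sum.reindex_bij_betw[OF h, of "\<lambda>i. \<Sum>x\<in>F. m i x * real (length (f i x))"] l by simp
  show ?thesis
    unfolding keyed_def
    by (rule exI[of _ "{0..<card I}"], rule exI[of _ "\<lambda>i. m (h i)"], rule exI[of _ "\<lambda>i. f (h i)"])
      (use nn bal p' l' hI in auto)
qed

section \<open>Operations on splittings\<close>

lemma keyed_mono: "keyed F p l \<Longrightarrow> l' \<le> l \<Longrightarrow> keyed F p l'"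
  unfolding keyed_def
  by (elim exE conjE, intro exI conjI) (assumption, assumption, assumption, linarith)

lemma keyed_cong: "(\<And>x. x \<in> F \<Longrightarrow> p x = q x) \<Longrightarrow> keyed F p l \<longleftrightarrow> keyed F q l"
  unfolding keyed_def by simp

lemma balanced_Nil: "balanced F m (\<lambda>_. [])"
  by (simp add: balanced_def)

lemma keyed_0:
  assumes "\<And>x. x \<in> F \<Longrightarrow> 0 \<le> p x"
  shows "keyed F p 0"
  by (rule keyedI[of "{()}" _ "\<lambda>_. p" "\<lambda>_ _. []"]) (auto simp: assms balanced_Nil)

lemma keyed_scale:
  assumes "keyed F p l" "0 \<le> c"
  shows "keyed F (\<lambda>x. c * p x) (c * l)"
proof -
  obtain I :: "nat set" and m f where I: "finite I" "\<And>i x. i \<in> I \<Longrightarrow> x \<in> F \<Longrightarrow> 0 \<le> m i x"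
    "\<And>i. i \<in> I \<Longrightarrow> balanced F (m i) (f i)" "\<And>x. x \<in> F \<Longrightarrow> (\<Sum>i\<in>I. m i x) = p x"
    "l \<le> (\<Sum>i\<in>I. \<Sum>x\<in>F. m i x * real (length (f i x)))"
    using assms(1) unfolding keyed_def by blast
  show ?thesis
  proof (rule keyedI[of I F "\<lambda>i x. c * m i x" f])
    show "balanced F (\<lambda>x. c * m i x) (f i)" if "i \<in> I" for i
      using I(3)[OF that] by (simp add: balanced_def sum_distrib_left[symmetric])
    show "c * l \<le> (\<Sum>i\<in>I. \<Sum>x\<in>F. c * m i x * real (length (f i x)))"
      using mult_left_mono[OF I(5) assms(2)] by (simp add: sum_distrib_left mult.assoc)
  qed (use I(1,2,4) assms(2) in \<open>auto simp: sum_distrib_left[symmetric]\<close>)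
qed

lemma keyed_add:
  assumes "keyed F p k" "keyed F q l"
  shows "keyed F (\<lambda>x. p x + q x) (k + l)"
proof -
  obtain I :: "nat set" and m f where I: "finite I" "\<And>i x. i \<in> I \<Longrightarrow> x \<in> F \<Longrightarrow> 0 \<le> m i x"
    "\<And>i. i \<in> I \<Longrightarrow> balanced F (m i) (f i)" "\<And>x. x \<in> F \<Longrightarrow> (\<Sum>i\<in>I. m i x) = p x"
    "k \<le> (\<Sum>i\<in>I. \<Sum>x\<in>F. m i x * real (length (f i x)))"
    using assms(1) unfolding keyed_def by blast
  obtain J :: "nat set" and n g where J: "finite J" "\<And>i x. i \<in> J \<Longrightarrow> x \<in> F \<Longrightarrow> 0 \<le> n i x"
    "\<And>i. i \<in> J \<Longrightarrow> balanced F (n i) (g i)" "\<And>x. x \<in> F \<Longrightarrow> (\<Sum>i\<in>J. n i x) = q x"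
    "l \<le> (\<Sum>i\<in>J. \<Sum>x\<in>F. n i x * real (length (g i x)))"
    using assms(2) unfolding keyed_def by blast
  show ?thesis
  proof (rule keyedI[of "I <+> J" F "case_sum m n" "case_sum f g"])
    show "finite (I <+> J)" using I(1) J(1) by simp
    show "0 \<le> case_sum m n i x" if "i \<in> I <+> J" "x \<in> F" for i x
      using that I(2) J(2) by auto
    show "balanced F (case_sum m n i) (case_sum f g i)" if "i \<in> I <+> J" for i
      using that I(3) J(3) by auto
    show "(\<Sum>i\<in>I <+> J. case_sum m n i x) = p x + q x" if "x \<in> F" for x
      using I(4)[OF that] J(4)[OF that] by (simp add: sum.Plus[OF I(1) J(1)])
    show "k + l \<le> (\<Sum>i\<in>I <+> J. \<Sum>x\<in>F. case_sum m n i x * real (length (case_sum f g i x)))"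
      using add_mono[OF I(5) J(5)] by (simp add: sum.Plus[OF I(1) J(1)])
  qed
qed

text \<open>Every atom \<open>i\<close> of \<open>A\<close> is paired with every atom
  \<open>j\<close> of \<open>B\<close>. Cut proportionally, both sides of the pair have mass
  \<open>t i * u j / s\<close>, so a leading bit telling \<open>A\<close> from \<open>B\<close> is
  fair. It adds one bit on the total mass \<open>2 * s\<close>.\<close>

lemma keyed_halves:
  assumes fin: "finite A" "finite B" and disj: "A \<inter> B = {}"
    and A: "keyed A p k" "sum p A = s" and B: "keyed B q l" "sum q B = s" and s: "0 < s"
  shows "keyed (A \<union> B) (\<lambda>x. if x \<in> A then p x else q x) (k + l + 2 * s)"
proof -
  obtain I :: "nat set" and m f where I: "finite I" "\<And>i x. i \<in> I \<Longrightarrow> x \<in> A \<Longrightarrow> 0 \<le> m i x"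
    "\<And>i. i \<in> I \<Longrightarrow> balanced A (m i) (f i)" "\<And>x. x \<in> A \<Longrightarrow> (\<Sum>i\<in>I. m i x) = p x"
    "k \<le> (\<Sum>i\<in>I. \<Sum>x\<in>A. m i x * real (length (f i x)))"
    using A(1) unfolding keyed_def by blast
  obtain J :: "nat set" and n g where J: "finite J" "\<And>i x. i \<in> J \<Longrightarrow> x \<in> B \<Longrightarrow> 0 \<le> n i x"
    "\<And>i. i \<in> J \<Longrightarrow> balanced B (n i) (g i)" "\<And>x. x \<in> B \<Longrightarrow> (\<Sum>i\<in>J. n i x) = q x"
    "l \<le> (\<Sum>i\<in>J. \<Sum>x\<in>B. n i x * real (length (g i x)))"
    using B(1) unfolding keyed_def by blast
  define t where "t i = sum (m i) A" for i
  define u where "u j = sum (n j) B" for j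
  have t: "sum t I = s" "\<And>i. i \<in> I \<Longrightarrow> 0 \<le> t i"
    unfolding t_def by (subst sum.swap) (use I(2,4) A(2) in \<open>auto intro: sum_nonneg\<close>)
  have u: "sum u J = s" "\<And>j. j \<in> J \<Longrightarrow> 0 \<le> u j"
    unfolding u_def by (subst sum.swap) (use J(2,4) B(2) in \<open>auto intro: sum_nonneg\<close>)
  define M where "M = (\<lambda>(i, j) x. if x \<in> A then m i x * (u j / s) else n j x * (t i / s))"
  define h where "h = (\<lambda>(i, j) x. if x \<in> A then False # f i x else True # g j x)"
  define L where "L i = (\<Sum>x\<in>A. m i x * real (length (f i x)))" for i
  define R where "R j = (\<Sum>x\<in>B. n j x * real (length (g j x)))" for j
  have nA: "x \<in> B \<Longrightarrow> x \<notin> A" for x using disj by auto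
  have sumA: "sum (M (i, j)) {x \<in> A. P x} = sum (m i) {x \<in> A. P x} * (u j / s)" for i j P
    unfolding sum_distrib_right by (rule sum.cong) (auto simp: M_def)
  have sumB: "sum (M (i, j)) {x \<in> B. P x} = sum (n j) {x \<in> B. P x} * (t i / s)" for i j P
    unfolding sum_distrib_right by (rule sum.cong) (auto simp: M_def nA)
  show ?thesis
  proof (rule keyedI[of "I \<times> J" _ M h])
    fix ij x assume "ij \<in> I \<times> J" "x \<in> A \<union> B"
    then show "0 \<le> M ij x" using I(2) J(2) t(2) u(2) s by (auto simp: M_def)
  next
    fix ij assume "ij \<in> I \<times> J"
    then obtain i j where ij: "ij = (i, j)" "i \<in> I" "j \<in> J" by auto
    show "balanced (A \<union> B) (M ij) (h ij)"
      unfolding balanced_def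
    proof
      fix v
      show "sum (M ij) {x \<in> A \<union> B. prefix (v @ [False]) (h ij x)} = sum (M ij) {x \<in> A \<union> B. prefix (v @ [True]) (h ij x)}"
      \<comment> \<open>At the empty prefix fairness is the equality of the two masses; after the
        leading bit only one side remains, and its own balance applies.\<close>
      proof (cases v)
        case Nil
        have "{x \<in> A \<union> B. prefix (v @ [False]) (h ij x)} = {x \<in> A. True}"
          "{x \<in> A \<union> B. prefix (v @ [True]) (h ij x)} = {x \<in> B. True}"
          using nA by (auto simp: Nil h_def ij)
        then show ?thesis using sumA[of i j "\<lambda>_. True"] sumB[of i j "\<lambda>_. True"]
          by (simp add: ij t_def u_def)
      next
        case (Cons c v')
        show ?thesis
        proof (cases c)
          case True
          have "{x \<in> A \<union> B. prefix (v @ [b]) (h ij x)} = {x \<in> B. prefix (v' @ [b]) (g j x)}" for b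
            using nA by (auto simp: Cons True h_def ij)
          then show ?thesis using J(3)[OF ij(3)] by (simp add: ij(1) sumB balanced_def)
        next
          case False
          have "{x \<in> A \<union> B. prefix (v @ [b]) (h ij x)} = {x \<in> A. prefix (v' @ [b]) (f i x)}" for b
            using nA by (auto simp: Cons False h_def ij)
          then show ?thesis using I(3)[OF ij(2)] by (simp add: ij(1) sumA balanced_def)
        qed
      qed
    qed
  next
    fix x assume x: "x \<in> A \<union> B"
    show "(\<Sum>ij\<in>I \<times> J. M ij x) = (if x \<in> A then p x else q x)"
    proof (cases "x \<in> A")
      case True
      then have "(\<Sum>ij\<in>I \<times> J. M ij x) = (\<Sum>i\<in>I. \<Sum>j\<in>J. m i x * (u j / s))"
        by (simp add: sum.cartesian_product M_def case_prod_unfold)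
      also have "\<dots> = (\<Sum>i\<in>I. m i x) * (\<Sum>j\<in>J. u j / s)"
        by (simp add: sum_product)
      also have "(\<Sum>j\<in>J. u j / s) = 1" using u(1) s by (simp add: sum_divide_distrib[symmetric])
      finally show ?thesis using True I(4) by simp
    next
      case False
      then have "(\<Sum>ij\<in>I \<times> J. M ij x) = (\<Sum>i\<in>I. \<Sum>j\<in>J. (t i / s) * n j x)"
        by (simp add: sum.cartesian_product M_def case_prod_unfold mult.commute)
      also have "\<dots> = (\<Sum>i\<in>I. t i / s) * (\<Sum>j\<in>J. n j x)"
        by (simp add: sum_product)
      also have "(\<Sum>i\<in>I. t i / s) = 1" using t(1) s by (simp add: sum_divide_distrib[symmetric])
      finally show ?thesis using False x J(4) by simp
    qed
  next
    have "(\<Sum>x\<in>A \<union> B. M (i, j) x * real (length (h (i, j) x)))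
        = (t i + L i) * (u j / s) + (t i / s) * (u j + R j)" for i j
    proof -
      have "(\<Sum>x\<in>A. M (i, j) x * real (length (h (i, j) x))) = (\<Sum>x\<in>A. (m i x + m i x * real (length (f i x))) * (u j / s))"
        by (rule sum.cong) (auto simp: M_def h_def algebra_simps add_divide_distrib)
      also have "\<dots> = (t i + L i) * (u j / s)"
        by (simp only: sum_distrib_right[symmetric] sum.distrib t_def L_def)
      finally have 1: "(\<Sum>x\<in>A. M (i, j) x * real (length (h (i, j) x))) = (t i + L i) * (u j / s)" .
      have "(\<Sum>x\<in>B. M (i, j) x * real (length (h (i, j) x))) = (\<Sum>x\<in>B. (t i / s) * (n j x + n j x * real (length (g j x))))"
        by (rule sum.cong) (auto simp: M_def h_def nA algebra_simps add_divide_distrib)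
      also have "\<dots> = (t i / s) * (u j + R j)"
        by (simp only: sum_distrib_left[symmetric] sum.distrib u_def R_def)
      finally show ?thesis using 1 by (simp add: sum.union_disjoint[OF fin disj])
    qed
    then have "(\<Sum>i\<in>I. \<Sum>j\<in>J. \<Sum>x\<in>A \<union> B. M (i, j) x * real (length (h (i, j) x)))
        = (\<Sum>i\<in>I. \<Sum>j\<in>J. (t i + L i) * (u j / s) + (t i / s) * (u j + R j))"
      by simp
    also have "\<dots> = (\<Sum>i\<in>I. t i + L i) * (\<Sum>j\<in>J. u j / s) + (\<Sum>i\<in>I. t i / s) * (\<Sum>j\<in>J. u j + R j)"
      by (simp only: sum_product sum.distrib[symmetric])
    also have "\<dots> = (s + sum L I) + (s + sum R J)"
      using t(1) u(1) s by (simp add: sum_divide_distrib[symmetric] sum.distrib)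
    finally show "k + l + 2 * s \<le> (\<Sum>ij\<in>I \<times> J. \<Sum>x\<in>A \<union> B. M ij x * real (length (h ij x)))"
      using I(5) J(5) sum.cartesian_product[of "\<lambda>i j. \<Sum>x\<in>A \<union> B. M (i, j) x * real (length (h (i, j) x))" J I]
      by (simp add: L_def R_def case_prod_unfold)
  qed (use I(1) J(1) in auto)
qed

section \<open>Finite support\<close>

text \<open>The chord of \<open>s log (1/s)\<close> through its values at \<open>2^-k\<close> and \<open>2^-(k+1)\<close>.\<close>

definition chord :: "nat \<Rightarrow> real \<Rightarrow> real" where
  "chord k s = (1/2) ^ k + (real k - 1) * s"

text \<open>Closed at both ends, so that a probability pushed to a power of 1/2 keeps its level.
  Such a power may belong to two levels, whose chords agree there.\<close>

definition level :: "nat \<Rightarrow> real \<Rightarrow> bool" where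
  "level k s \<longleftrightarrow> (1/2) ^ Suc k \<le> s \<and> s \<le> (1/2) ^ k"

lemma level_pos: "level k s \<Longrightarrow> 0 < s"
  unfolding level_def by (rule less_le_trans[of _ "(1/2) ^ Suc k"]) auto

section \<open>Comparison of \<open>s log (1/s)\<close> with its chord\<close>

lemma ex_level:
  assumes "0 < s" "s \<le> 1"
  shows "\<exists>k. level k s"
proof -
  obtain n where "(1/2) ^ n < s" using real_arch_pow_inv[OF assms(1), of "1/2"] by auto
  then have ex: "\<exists>n. (1/2) ^ Suc n \<le> s"
    by (intro exI[of _ n]) (use assms(1) in simp)
  define k where "k = (LEAST n. (1/2) ^ Suc n \<le> s)"
  have 1: "(1/2) ^ Suc k \<le> s" unfolding k_def using ex by (rule LeastI_ex)
  have 2: "s \<le> (1/2) ^ k"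
  proof (cases k)
    case 0 then show ?thesis using assms by simp
  next
    case (Suc j)
    then have "\<not> (1/2) ^ Suc j \<le> s" using not_less_Least[of j "\<lambda>n. (1/2) ^ Suc n \<le> s"] by (simp add: k_def)
    then show ?thesis using Suc by simp
  qed
  show ?thesis using 1 2 unfolding level_def by blast
qed

text \<open>The lower bound is weighted AM-GM, \<open>2 powr (v - 1) \<le> v\<close>. The upper one
  is \<open>ln v \<le> v - 1\<close> with \<open>ln 2 \<ge> 2/3\<close>, giving
  \<open>3/2 * (v - 1)\<close>, which is at most \<open>v - 1/2\<close> because
  \<open>v \<le> 2\<close>.\<close>

lemma log2_bounds:
  assumes "1 \<le> v" "v \<le> 2"
  shows "v - 1 \<le> log 2 v" "log 2 v \<le> v - 1 / 2"
proof -
  have "2 powr (v - 1) * 1 powr (2 - v) \<le> (v - 1) * 2 + (2 - v) * 1"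
    by (rule Youngs_inequality_0) (use assms in auto)
  then have "2 powr (v - 1) \<le> v" by simp
  then show "v - 1 \<le> log 2 v" using assms by (simp add: le_log_iff)
  have l2: "2/3 \<le> ln (2::real)" using ln2_ge_two_thirds by simp
  have "log 2 v = ln v / ln 2" by (simp add: log_def)
  also have "\<dots> \<le> (v - 1) / (2/3)"
    by (rule frac_le) (use assms l2 ln_le_minus_one[of v] in auto)
  finally show "log 2 v \<le> v - 1 / 2" using assms by simp
qed

text \<open>With \<open>v = 2^-k / s\<close> in [1,2], the two sides are
  \<open>s * (k + log 2 v)\<close> and \<open>s * (k + v - 1)\<close>. Summed over a law, the
  replacement costs at most 1/2 bit.\<close>

lemma chord_bounds:
  assumes "level k s"
  shows "chord k s \<le> s * log 2 (1 / s)" "s * log 2 (1 / s) \<le> chord k s + s / 2"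
proof -
  have s: "0 < s" using assms by (rule level_pos)
  define v where "v = (1/2) ^ k / s"
  have v: "1 \<le> v" "v \<le> 2" using assms s by (auto simp: v_def level_def field_simps)
  have sv: "s * v = (1/2) ^ k" using s by (simp add: v_def)
  have "1 / s = v * 2 ^ k" using s by (simp add: v_def power_one_over)
  then have lg: "log 2 (1 / s) = log 2 v + real k"
    using v by (simp add: log_mult log_nat_power)
  have "s * (v - 1) \<le> s * log 2 v" "s * log 2 v \<le> s * (v - 1 / 2)"
    using log2_bounds[OF v] s by (auto intro: mult_left_mono)
  then show "chord k s \<le> s * log 2 (1 / s)" "s * log 2 (1 / s) \<le> chord k s + s / 2"
    unfolding lg chord_def sv[symmetric] by (auto simp: algebra_simps)
qed

text \<open>Bounds the cost of renormalising the rest in \<open>keyed_heavy_point\<close>. Using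
  \<open>ln 2 \<ge> 2/3\<close>, the left side is in fact at most 3/4.\<close>

lemma log2_inverse_le:
  assumes "0 < t" "t \<le> 1 / 2"
  shows "t * log 2 (1 / t) + t / 2 \<le> 1"
proof -
  have l2: "2/3 \<le> ln (2::real)" using ln2_ge_two_thirds by simp
  have "1 / t = 2 * (1 / (2 * t))" by simp
  then have "log 2 (1 / t) = 1 + log 2 (1 / (2 * t))"
    using assms by (simp only: log_mult) simp
  also have "log 2 (1 / (2 * t)) = ln (1 / (2 * t)) / ln 2" by (simp add: log_def)
  also have "\<dots> \<le> (1 / (2 * t) - 1) / (2/3)"
    by (rule frac_le) (use assms l2 ln_le_minus_one[of "1 / (2 * t)"] in \<open>auto simp: field_simps\<close>)
  finally have "t * log 2 (1 / t) \<le> t * (1 + (1 / (2 * t) - 1) / (2/3))"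
    using assms by (auto intro: mult_left_mono)
  also have "\<dots> = 3/4 - t/2" using assms by (simp add: field_simps)
  finally show ?thesis by simp
qed

text \<open>Division by \<open>t\<close> does not map dyadic intervals to dyadic intervals, so the
  comparison passes through \<open>s log (1/s)\<close>, which rescales exactly; coming back to the
  chord costs \<open>t / 2\<close>.\<close>

lemma chord_sum_rescale:
  assumes B: "finite B" "sum p B = t" and t: "0 < t"
    and k: "\<And>x. x \<in> B \<Longrightarrow> level (k x) (p x)"
    and j: "\<And>x. x \<in> B \<Longrightarrow> level (j x) (p x / t)"
  shows "(\<Sum>x\<in>B. chord (k x) (p x)) \<le> t * (\<Sum>x\<in>B. chord (j x) (p x / t)) + t * log 2 (1 / t) + t / 2"
proof -
  have "chord (k x) (p x) \<le> t * chord (j x) (p x / t) + p x * log 2 (1 / t) + p x / 2" if x: "x \<in> B" for x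
  proof -
    have px: "0 < p x" using level_pos[OF k[OF x]] .
    have "1 / p x = (1 / (p x / t)) * (1 / t)" using t by simp
    then have "log 2 (1 / p x) = log 2 (1 / (p x / t)) + log 2 (1 / t)"
      using t px by (simp only: log_mult) simp
    then have "p x * log 2 (1 / p x) = t * (p x / t * log 2 (1 / (p x / t))) + p x * log 2 (1 / t)"
      using t by (simp add: algebra_simps)
    also have "\<dots> \<le> t * (chord (j x) (p x / t) + p x / t / 2) + p x * log 2 (1 / t)"
      using mult_left_mono[OF chord_bounds(2)[OF j[OF x]], of t] t by linarith
    also have "\<dots> = t * chord (j x) (p x / t) + p x * log 2 (1 / t) + p x / 2"
      using t by (simp add: algebra_simps)
    finally show ?thesis using chord_bounds(1)[OF k[OF x]] by linarith
  qed
  then have "(\<Sum>x\<in>B. chord (k x) (p x)) \<le> (\<Sum>x\<in>B. t * chord (j x) (p x / t) + p x * log 2 (1 / t) + p x / 2)"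
    by (rule sum_mono)
  also have "\<dots> = t * (\<Sum>x\<in>B. chord (j x) (p x / t)) + t * log 2 (1 / t) + t / 2"
    using B(2) by (simp add: sum.distrib sum_distrib_left[symmetric] sum_distrib_right[symmetric] sum_divide_distrib[symmetric])
  finally show ?thesis .
qed

text \<open>With \<open>t = 1 - p x\<close>, mass \<open>t\<close> of the point \<open>x\<close> is balanced against the remaining points; the mass
  \<open>p x - t\<close> left over gets the empty key.\<close>

lemma keyed_heavy_point:
  assumes F: "finite F" "x \<in> F" "sum p F = 1"
    and k: "\<And>y. y \<in> F \<Longrightarrow> level (k y) (p y)"
    and heavy: "1 / 2 \<le> p x"
    and IH: "\<And>q j. (\<And>y. y \<in> F - {x} \<Longrightarrow> level (j y) (q y)) \<Longrightarrow> sum q (F - {x}) = 1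
      \<Longrightarrow> keyed (F - {x}) q ((\<Sum>y\<in>F - {x}. chord (j y) (q y)) - 1)"
  shows "keyed F p ((\<Sum>y\<in>F. chord (k y) (p y)) - 1)"
proof -
  define B where "B = F - {x}"
  define t where "t = sum p B"
  have FB: "F = insert x B" "x \<notin> B" "finite B" using F by (auto simp: B_def)
  have t: "t = 1 - p x" using F(3) FB by (simp add: t_def)
  have pB: "0 < p y" if "y \<in> B" for y using level_pos[OF k] that FB by auto
  have t0: "0 \<le> t" unfolding t_def using pB by (intro sum_nonneg) (auto intro: less_imp_le)
  \<comment> \<open>A probability of at least 1/2 has level 0, where the chord is
    \<open>1 - p x\<close>, or is exactly 1/2 at level 1.\<close>
  have cx: "chord (k x) (p x) \<le> t"
  proof -
    have lx: "p x \<le> (1/2) ^ k x" using k[OF F(2)] by (simp add: level_def)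
    have "k x < 2"
    proof (rule ccontr)
      assume "\<not> k x < 2"
      then have "(1/2 :: real) ^ k x \<le> (1/2) ^ 2" by (intro power_decreasing) auto
      then show False using lx heavy by (simp add: power2_eq_square)
    qed
    then consider "k x = 0" | "k x = 1" by linarith
    then show ?thesis using lx heavy by cases (auto simp: chord_def t)
  qed
  show ?thesis
  proof (cases "B = {}")
    case True
    have "keyed F p 0" by (rule keyed_0) (use level_pos[OF k] less_imp_le in blast)
    then show ?thesis
      by (rule keyed_mono) (use True FB cx t heavy in \<open>simp add: t_def\<close>)
  next
    case False
    have tpos: "0 < t" unfolding t_def using False FB pB by (intro sum_pos) auto
    have "\<exists>j. level j (p y / t)" if "y \<in> B" for y
      by (rule ex_level) (use pB[OF that] tpos member_le_sum[of y B p] that FB less_imp_le[OF pB] in \<open>auto simp: t_def\<close>)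
    then obtain j where j: "\<And>y. y \<in> B \<Longrightarrow> level (j y) (p y / t)" by metis
    define S where "S = (\<Sum>y\<in>B. chord (j y) (p y / t))"
    have "keyed B (\<lambda>y. p y / t) (S - 1)"
      unfolding S_def B_def
      by (rule IH) (use j tpos in \<open>auto simp: B_def[symmetric] sum_divide_distrib[symmetric] t_def[symmetric]\<close>)
    then have "keyed B (\<lambda>y. t * (p y / t)) (t * (S - 1))"
      by (rule keyed_scale) (rule t0)
    moreover have "keyed {x} (\<lambda>_. t) 0" by (rule keyed_0) (rule t0)
    ultimately have "keyed ({x} \<union> B) (\<lambda>y. if y \<in> {x} then t else t * (p y / t)) (0 + t * (S - 1) + 2 * t)"
      by (intro keyed_halves) (use FB tpos in \<open>auto simp: t_def[symmetric]\<close>)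
    moreover have "keyed ({x} \<union> B) (\<lambda>y. if y = x then p x - t else 0) 0"
      by (rule keyed_0) (use t heavy in auto)
    ultimately have "keyed ({x} \<union> B) (\<lambda>y. (if y \<in> {x} then t else t * (p y / t)) + (if y = x then p x - t else 0))
        (0 + t * (S - 1) + 2 * t + 0)"
      by (rule keyed_add)
    then have "keyed F p (0 + t * (S - 1) + 2 * t + 0)"
      by (subst keyed_cong) (use FB tpos in auto)
    then show ?thesis
    proof (rule keyed_mono)
      \<comment> \<open>The bound obtained is \<open>t * S + t\<close>. The \<open>t\<close> absorbs
        the chord of \<open>x\<close>, and the cost of rescaling is covered by the
        \<open>- 1\<close> of the claim.\<close>
      have "(\<Sum>y\<in>B. chord (k y) (p y)) \<le> t * S + t * log 2 (1 / t) + t / 2"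
        unfolding S_def by (rule chord_sum_rescale) (use FB t_def tpos k j in auto)
      moreover have "t * log 2 (1 / t) + t / 2 \<le> 1"
        by (rule log2_inverse_le) (use tpos t heavy in auto)
      ultimately show "(\<Sum>y\<in>F. chord (k y) (p y)) - 1 \<le> 0 + t * (S - 1) + 2 * t + 0"
        using cx FB by (simp add: algebra_simps)
    qed
  qed
qed

text \<open>Doubling lowers every level by exactly one, so the chord sum transforms without loss.
  Scaled back, each half is short by 1 of its own chord sum, and the leading bit restores 1 of these
  2.\<close>

lemma keyed_exact_halves:
  assumes F: "finite F" "A \<subseteq> F" and A: "sum p A = 1 / 2" "sum p (F - A) = 1 / 2"
    and k: "\<And>x. x \<in> F \<Longrightarrow> level (k x) (p x)" "\<And>x. x \<in> F \<Longrightarrow> 1 \<le> k x"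
    and IH: "\<And>B q j. B \<subset> F \<Longrightarrow> (\<And>y. y \<in> B \<Longrightarrow> level (j y) (q y)) \<Longrightarrow> sum q B = 1
      \<Longrightarrow> keyed B q ((\<Sum>y\<in>B. chord (j y) (q y)) - 1)"
  shows "keyed F p ((\<Sum>x\<in>F. chord (k x) (p x)) - 1)"
proof -
  define S where "S B = (\<Sum>x\<in>B. chord (k x) (p x))" for B
  have *: "keyed B p (S B - 1)" if B: "B \<subset> F" "sum p B = 1 / 2" for B
  proof -
    have "keyed B (\<lambda>x. 2 * p x) ((\<Sum>x\<in>B. chord (k x - 1) (2 * p x)) - 1)"
    proof (rule IH)
      show "level (k y - 1) (2 * p y)" if "y \<in> B" for y
      proof -
        have y: "y \<in> F" using that B by auto
        then obtain i where "k y = Suc i" using k(2)[OF y] by (cases "k y") auto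
        then show ?thesis using k(1)[OF y] by (simp add: level_def)
      qed
    qed (use B in \<open>auto simp: sum_distrib_left[symmetric]\<close>)
    then have "keyed B (\<lambda>x. (1/2) * (2 * p x)) ((1/2) * ((\<Sum>x\<in>B. chord (k x - 1) (2 * p x)) - 1))"
      by (rule keyed_scale) simp
    moreover have "(\<Sum>x\<in>B. chord (k x - 1) (2 * p x)) = (\<Sum>x\<in>B. 2 * (chord (k x) (p x) - p x))"
    proof (rule sum.cong)
      fix y assume "y \<in> B"
      then have y: "y \<in> F" using B by auto
      then obtain i where "k y = Suc i" using k(2)[OF y] by (cases "k y") auto
      then show "chord (k y - 1) (2 * p y) = 2 * (chord (k y) (p y) - p y)"
        by (simp add: chord_def algebra_simps)
    qed simp
    moreover have "(\<Sum>x\<in>B. 2 * (chord (k x) (p x) - p x)) = 2 * (S B - 1 / 2)"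
      using B(2) by (simp only: S_def sum_subtractf sum_distrib_left[symmetric])
    ultimately show ?thesis by (simp add: diff_divide_distrib)
  qed
  have "A \<noteq> {}" "F - A \<noteq> {}" using A by (metis sum.empty div_0 zero_neq_one divide_eq_0_iff zero_neq_numeral)+
  then have sub: "A \<subset> F" "F - A \<subset> F" using F by auto
  have "keyed (A \<union> (F - A)) (\<lambda>x. if x \<in> A then p x else p x) ((S A - 1) + (S (F - A) - 1) + 2 * (1 / 2))"
    by (rule keyed_halves) (use F A * sub in \<open>auto intro: finite_subset\<close>)
  moreover have "S F = S A + S (F - A)" unfolding S_def using F
    by (simp add: sum.subset_diff add.commute)
  moreover have "A \<union> (F - A) = F" using F by auto
  ultimately show ?thesis unfolding S_def[symmetric] by simp
qed

text \<open>Supplies the set of probability exactly 1/2. Smallest terms are dropped one at a time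
  until the next removal would fall below 1/2; the sum then equals 1/2.\<close>

lemma dyadic_subset_sum:
  assumes "finite E" "\<And>x. x \<in> E \<Longrightarrow> 1 \<le> e x" "1 / 2 \<le> (\<Sum>x\<in>E. (1/2 :: real) ^ e x)"
  shows "\<exists>A\<subseteq>E. (\<Sum>x\<in>A. (1/2 :: real) ^ e x) = 1 / 2"
  using assms
proof (induction E rule: finite_psubset_induct)
  case (psubset E)
  have "E \<noteq> {}" using psubset.prems(2) by auto
  then obtain x where x: "x \<in> E" "e x = Max (e ` E)"
    using psubset.hyps by (metis (no_types, lifting) Max_in finite_imageI image_iff image_is_empty)
  have mx: "e y \<le> e x" if "y \<in> E" for y using psubset.hyps that x by simp
  let ?s = "\<lambda>A. \<Sum>x\<in>A. (1/2 :: real) ^ e x"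
  \<comment> \<open>All terms, and \<open>1/2\<close>, are multiples of the smallest term, so dropping it cannot jump over \<open>1/2\<close>.\<close>
  have sE: "?s E = (1/2) ^ e x + ?s (E - {x})"
    using psubset.hyps x by (simp add: sum.remove)
  show ?case
  proof (cases "1 / 2 \<le> ?s (E - {x})")
    case True
    then have "\<exists>A\<subseteq>E - {x}. ?s A = 1 / 2"
      using psubset.IH[of "E - {x}"] x psubset.prems by auto
    then show ?thesis by blast
  next
    case False
    have pw: "(1/2 :: real) ^ n = real (2 ^ (e x - n)) * (1/2) ^ e x" if "n \<le> e x" for n
    proof -
      have "(2 :: real) ^ n * 2 ^ (e x - n) = 2 ^ e x"
        using that by (simp add: power_add[symmetric])
      then show ?thesis by (simp add: power_one_over field_simps)
    qed
    define N where "N = (\<Sum>y\<in>E - {x}. (2 :: nat) ^ (e x - e y))"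
    have "?s (E - {x}) = (\<Sum>y\<in>E - {x}. real (2 ^ (e x - e y)) * (1/2) ^ e x)"
      by (rule sum.cong[OF refl], rule pw, rule mx) simp
    then have N: "?s (E - {x}) = real N * (1/2) ^ e x"
      by (simp add: N_def sum_distrib_right)
    have M: "(1/2 :: real) = real (2 ^ (e x - 1)) * (1/2) ^ e x"
      using pw[of 1] psubset.prems(1)[OF x(1)] by simp
    have "real N * (1/2) ^ e x < real (2 ^ (e x - 1)) * (1/2) ^ e x"
      using False N M by linarith
    then have "N < 2 ^ (e x - 1)" by (simp only: mult_less_cancel_right of_nat_less_iff) auto
    then have "real N + 1 \<le> real (2 ^ (e x - 1))" by (metis of_nat_Suc of_nat_le_iff Suc_leI add.commute)
    then have "(real N + 1) * (1/2) ^ e x \<le> real (2 ^ (e x - 1)) * (1/2) ^ e x"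
      by (rule mult_right_mono) simp
    then have "?s E \<le> 1 / 2" unfolding sE N M[symmetric] by (simp add: algebra_simps)
    then have "?s E = 1 / 2" using psubset.prems(2) by linarith
    then show ?thesis by blast
  qed
qed

section \<open>Moving probabilities onto the dyadic grid\<close>

definition off_grid :: "'a set \<Rightarrow> ('a \<Rightarrow> nat) \<Rightarrow> ('a \<Rightarrow> real) \<Rightarrow> 'a set" where
  "off_grid F k p = {x \<in> F. p x \<noteq> (1/2) ^ k x \<and> p x \<noteq> (1/2) ^ Suc (k x)}"

text \<open>Off-grid points are interior to their dyadic interval. Mass flows from \<open>y\<close>
  to \<open>x\<close> until \<open>x\<close> meets its upper end or \<open>y\<close> its lower end,
  whichever comes first; that point leaves the off-grid set and none enters.\<close>

lemma off_grid_shift: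
  assumes F: "finite F" "x \<in> off_grid F k p" "y \<in> off_grid F k p" "x \<noteq> y"
    and k: "\<And>z. z \<in> F \<Longrightarrow> level (k z) (p z)"
  shows "\<exists>u>0. (\<forall>z\<in>F. level (k z) ((p(x := p x + u, y := p y - u)) z)) \<and>
    sum (p(x := p x + u, y := p y - u)) F = sum p F \<and>
    card (off_grid F k (p(x := p x + u, y := p y - u))) < card (off_grid F k p)"
proof -
  define u where "u = min ((1/2) ^ k x - p x) (p y - (1/2) ^ Suc (k y))"
  define q where "q = p(x := p x + u, y := p y - u)"
  have xy: "x \<in> F" "y \<in> F" using F by (auto simp: off_grid_def)
  have u: "0 < u" using F k[OF xy(1)] k[OF xy(2)] by (auto simp: u_def off_grid_def level_def)
  have ule: "u \<le> (1/2) ^ k x - p x" "u \<le> p y - (1/2) ^ Suc (k y)" by (auto simp: u_def)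
  have lev: "level (k z) (q z)" if "z \<in> F" for z
    using k[OF that] u ule F(4) by (auto simp: q_def level_def)
  have split: "sum g F = g x + (g y + sum g (F - {x} - {y}))" for g :: "'a \<Rightarrow> real"
    using sum.remove[of F x g] sum.remove[of "F - {x}" y g] F(1,4) xy by simp
  have "sum q F = q x + (q y + sum q (F - {x} - {y}))" by (rule split)
  also have "sum q (F - {x} - {y}) = sum p (F - {x} - {y})"
    by (rule sum.cong) (auto simp: q_def)
  also have "q x + (q y + sum p (F - {x} - {y})) = p x + (p y + sum p (F - {x} - {y}))"
    using F(4) by (simp add: q_def)
  also have "\<dots> = sum p F" by (rule split[symmetric])
  finally have sum: "sum q F = sum p F" .
  have fin: "finite (off_grid F k p)" using F(1) by (simp add: off_grid_def)
  have sub: "off_grid F k q \<subseteq> off_grid F k p"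
  proof
    fix z assume z: "z \<in> off_grid F k q"
    show "z \<in> off_grid F k p"
      using F(2,3) z by (cases "z = x \<or> z = y") (auto simp: off_grid_def q_def)
  qed
  have "x \<notin> off_grid F k q \<or> y \<notin> off_grid F k q"
  proof (cases "(1/2) ^ k x - p x \<le> p y - (1/2) ^ Suc (k y)")
    case True
    then have "q x = (1/2) ^ k x" using F(4) by (simp add: q_def u_def)
    then show ?thesis by (simp add: off_grid_def)
  next
    case False
    then have "q y = (1/2) ^ Suc (k y)" by (simp add: q_def u_def)
    then show ?thesis by (simp add: off_grid_def)
  qed
  then have "off_grid F k q \<subset> off_grid F k p" using sub F(2,3) by auto
  then have "card (off_grid F k q) < card (off_grid F k p)" using fin by (rule psubset_card_mono[rotated])
  then show ?thesis
    by (intro exI[of _ u]) (unfold q_def[symmetric], use u lev sum in simp)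
qed

text \<open>The outer induction on the support serves halving and heavy points; the inner one, on
  the number of off-grid points, serves the moves along a line.\<close>

lemma keyed_levels:
  assumes "finite F" "\<And>x. x \<in> F \<Longrightarrow> level (k x) (p x)" "sum p F = 1"
  shows "keyed F p ((\<Sum>x\<in>F. chord (k x) (p x)) - 1)"
  using assms
proof (induction F arbitrary: p k rule: finite_psubset_induct)
  case (psubset F)
  note fin = \<open>finite F\<close>
  from psubset.prems show ?case
  proof (induction "card (off_grid F k p)" arbitrary: p rule: less_induct)
    case less
    show ?case
    proof (cases "\<exists>x\<in>F. 1 / 2 \<le> p x")
      case True
      then obtain x where x: "x \<in> F" "1 / 2 \<le> p x" by blast
      show ?thesis
        by (rule keyed_heavy_point[OF fin x(1) less.prems(2) less.prems(1) x(2)])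
          (assumption, rule psubset.IH, use x(1) in auto)
    next
      case False
      then have light: "p x < 1 / 2" if "x \<in> F" for x using that by force
      have k1: "1 \<le> k x" if "x \<in> F" for x
        using less.prems(1)[OF that] light[OF that] by (cases "k x") (auto simp: level_def)
      show ?thesis
      proof (cases "\<exists>x\<in>off_grid F k p. \<exists>y\<in>off_grid F k p. x \<noteq> y")
        case True
        then obtain x y where xy: "x \<in> off_grid F k p" "y \<in> off_grid F k p" "x \<noteq> y" by blast
        obtain u where u: "0 < u" "\<forall>z\<in>F. level (k z) ((p(x := p x + u, y := p y - u)) z)"
          "sum (p(x := p x + u, y := p y - u)) F = sum p F"
          "card (off_grid F k (p(x := p x + u, y := p y - u))) < card (off_grid F k p)"
          using off_grid_shift[OF fin xy less.prems(1)] by blast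
        obtain v where v: "0 < v" "\<forall>z\<in>F. level (k z) ((p(y := p y + v, x := p x - v)) z)"
          "sum (p(y := p y + v, x := p x - v)) F = sum p F"
          "card (off_grid F k (p(y := p y + v, x := p x - v))) < card (off_grid F k p)"
          using off_grid_shift[OF fin xy(2,1) xy(3)[symmetric] less.prems(1)] by blast
        define q where "q = p(x := p x + u, y := p y - u)"
        define r where "r = p(y := p y + v, x := p x - v)"
        \<comment> \<open>Weights for which the shifts by \<open>u\<close> and \<open>v\<close>
          cancel, so that \<open>p\<close> is a mean of \<open>q\<close> and \<open>r\<close>. As
          \<open>k\<close> is unchanged, the chord sum of \<open>p\<close> is the same mean.\<close>
        define c where "c = v / (u + v)"
        define d where "d = u / (u + v)"
        have cd: "0 \<le> c" "0 \<le> d" "c + d = 1" "c * u = d * v"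
          using u(1) v(1) by (auto simp: c_def d_def add_divide_distrib[symmetric])
        have p: "p z = c * q z + d * r z" for z
        proof -
          have "c * p z + d * p z = p z" by (simp only: distrib_right[symmetric] cd(3) mult_1)
          then show ?thesis using cd(4) xy(3) by (auto simp: q_def r_def algebra_simps)
        qed
        let ?C = "\<lambda>p. (\<Sum>x\<in>F. chord (k x) (p x)) - 1"
        have "keyed F q (?C q)"
          by (rule less.hyps) (use u[folded q_def] less.prems(2) in simp_all)
        moreover have "keyed F r (?C r)"
          by (rule less.hyps) (use v[folded r_def] less.prems(2) in simp_all)
        ultimately have "keyed F (\<lambda>z. c * q z + d * r z) (c * ?C q + d * ?C r)"
          by (intro keyed_add keyed_scale cd)
        moreover have "chord (k z) (p z) = c * chord (k z) (q z) + d * chord (k z) (r z)" for z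
        proof -
          have "c * (1/2) ^ k z + d * (1/2) ^ k z = (1/2) ^ k z" by (simp only: distrib_right[symmetric] cd(3) mult_1)
          then show ?thesis unfolding p[of z] chord_def by (simp add: algebra_simps)
        qed
        then have "?C p = c * ?C q + d * ?C r"
          using cd(3) by (simp add: sum.distrib sum_distrib_left algebra_simps)
        ultimately show ?thesis using keyed_cong[of F p "\<lambda>z. c * q z + d * r z"] p by simp
      next
        case False
        define E where "E = F - off_grid F k p"
        \<comment> \<open>The exponent of an on-grid probability, which sits at the upper or the
          lower end of its interval.\<close>
        define e where "e x = (if p x = (1/2) ^ k x then k x else Suc (k x))" for x
        have e: "p x = (1/2) ^ e x" if "x \<in> E" for x
          using that by (auto simp: E_def e_def off_grid_def)
        have e1: "1 \<le> e x" if "x \<in> E" for x using k1[of x] that by (auto simp: E_def e_def)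
        \<comment> \<open>At most one point is off the grid, and without heavy points it weighs less
          than 1/2. So the grid points carry at least 1/2.\<close>
        have "sum p (off_grid F k p) \<le> 1 / 2"
        proof (cases "off_grid F k p = {}")
          case False
          then obtain x where x: "x \<in> off_grid F k p" by blast
          then have "off_grid F k p = {x}" using \<open>\<not> (\<exists>x\<in>off_grid F k p. \<exists>y\<in>off_grid F k p. x \<noteq> y)\<close> by blast
          moreover have "x \<in> F" using x by (simp add: off_grid_def)
          ultimately show ?thesis using light[of x] by simp
        qed simp
        moreover have "sum p F = sum p E + sum p (off_grid F k p)"
          unfolding E_def using fin by (intro sum.subset_diff) (auto simp: off_grid_def)
        ultimately have "1 / 2 \<le> sum p E" using less.prems(2) by linarith
        also have "sum p E = (\<Sum>x\<in>E. (1/2) ^ e x)" using e by simp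
        finally obtain A where A: "A \<subseteq> E" "(\<Sum>x\<in>A. (1/2 :: real) ^ e x) = 1 / 2"
          using dyadic_subset_sum[of E e] fin e1 by (auto simp: E_def)
        have AF: "A \<subseteq> F" using A(1) by (auto simp: E_def)
        have "sum p A = (\<Sum>x\<in>A. (1/2) ^ e x)" by (rule sum.cong[OF refl], rule e) (use A(1) in auto)
        then have pA: "sum p A = 1 / 2" using A(2) by simp
        have "sum p (F - A) = 1 / 2"
          using sum.subset_diff[OF AF fin, of p] pA less.prems(2) by simp
        then show ?thesis
          by (rule keyed_exact_halves[OF fin AF pA _ less.prems(1) k1 psubset.IH])
      qed
    qed
  qed
qed

text \<open>Per unit of mass, 1 is lost in \<open>keyed_levels\<close> and 1/2 in
  \<open>chord_bounds\<close>. The term \<open>P * log 2 P\<close> comes from normalising to mass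
  1.\<close>

lemma keyed_entropy:
  assumes "finite F" "\<And>x. x \<in> F \<Longrightarrow> 0 < p x" "sum p F = P" "0 < P"
  shows "keyed F p ((\<Sum>x\<in>F. p x * log 2 (1 / p x)) + P * log 2 P - 3 / 2 * P)"
proof -
  have "\<exists>k. level k (p x / P)" if "x \<in> F" for x
  proof (rule ex_level)
    have "p x \<le> P"
      unfolding assms(3)[symmetric] using assms(1,2) that by (intro member_le_sum) (auto intro: less_imp_le)
    then show "p x / P \<le> 1" using assms(4) by simp
  qed (use assms that in auto)
  then obtain k where k: "\<And>x. x \<in> F \<Longrightarrow> level (k x) (p x / P)" by metis
  define S where "S = (\<Sum>x\<in>F. chord (k x) (p x / P))"
  have "keyed F (\<lambda>x. p x / P) (S - 1)"
    unfolding S_def by (rule keyed_levels) (use k assms in \<open>auto simp: sum_divide_distrib[symmetric]\<close>)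
  then have "keyed F (\<lambda>x. P * (p x / P)) (P * (S - 1))"
    by (rule keyed_scale) (use assms in auto)
  then have K: "keyed F p (P * (S - 1))" using assms(4) by simp
  have "p x * log 2 (1 / p x) \<le> P * chord (k x) (p x / P) - p x * log 2 P + p x / 2" if x: "x \<in> F" for x
  proof -
    have "p x / P * log 2 (1 / (p x / P)) \<le> chord (k x) (p x / P) + p x / P / 2"
      by (rule chord_bounds(2)[OF k[OF x]])
    from mult_left_mono[OF this, of P] have "p x * log 2 (1 / (p x / P)) \<le> P * chord (k x) (p x / P) + p x / 2"
      using assms(4) by (simp add: algebra_simps)
    moreover have "log 2 (1 / (p x / P)) = log 2 (1 / p x) + log 2 P"
      using assms(2)[OF x] assms(4) by (simp add: log_divide)
    ultimately show ?thesis by (simp add: algebra_simps)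
  qed
  then have "(\<Sum>x\<in>F. p x * log 2 (1 / p x)) \<le> (\<Sum>x\<in>F. P * chord (k x) (p x / P) - p x * log 2 P + p x / 2)"
    by (rule sum_mono)
  also have "\<dots> = P * S - P * log 2 P + P / 2"
    unfolding S_def assms(3)[symmetric]
    by (simp only: sum.distrib sum_subtractf sum_distrib_left sum_distrib_right sum_divide_distrib)
  finally show ?thesis by (intro keyed_mono[OF K]) (simp add: algebra_simps)
qed

section \<open>Arbitrary laws\<close>

lemma one_way_achieves_mono:
  "one_way_achieves PXY eps len \<Longrightarrow> len' \<le> len \<Longrightarrow> one_way_achieves PXY eps len'"
  unfolding one_way_achieves_def Let_def
  by (elim exE conjE, intro exI conjI) (assumption, assumption, assumption, erule order_trans)

text \<open>Given \<open>X = x\<close>, atom \<open>i\<close> must be drawn with probability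
  \<open>m i x / pmf PX x\<close>. Alice samples an index for every point of the finite set
  \<open>F\<close> in advance and sends the one at her \<open>x\<close>.\<close>

lemma one_way_achieves_keyed:
  fixes PX :: "'a pmf"
  assumes F: "finite F" "F \<subseteq> set_pmf PX" and key: "keyed F (pmf PX) l"
  shows "one_way_achieves (map_pmf (\<lambda>x. (x, x)) PX) 0 (ennreal l)"
proof -
  obtain I :: "nat set" and m f where I: "finite I" "\<And>i x. i \<in> I \<Longrightarrow> x \<in> F \<Longrightarrow> 0 \<le> m i x"
    "\<And>i. i \<in> I \<Longrightarrow> balanced F (m i) (f i)" "\<And>x. x \<in> F \<Longrightarrow> (\<Sum>i\<in>I. m i x) = pmf PX x"
    "l \<le> (\<Sum>i\<in>I. \<Sum>x\<in>F. m i x * real (length (f i x)))"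
    using key unfolding keyed_def by blast
  have pos: "0 < pmf PX x" if "x \<in> F" for x using F that by (auto simp: pmf_positive)
  have "\<exists>q. \<forall>i. pmf q i = (if i \<in> I then m i x / pmf PX x else 0)" if x: "x \<in> F" for x
  proof -
    let ?q = "\<lambda>i. if i \<in> I then m i x / pmf PX x else 0"
    have nn: "0 \<le> ?q i" for i using I(2)[OF _ x] by simp
    have "(\<integral>\<^sup>+ i. ennreal (?q i) \<partial>count_space UNIV) = (\<Sum>i\<in>I. ennreal (?q i))"
      by (rule nn_integral_count_space') (auto simp: I(1))
    also have "\<dots> = ennreal (\<Sum>i\<in>I. ?q i)" by (rule sum_ennreal) (rule nn)
    also have "(\<Sum>i\<in>I. ?q i) = (\<Sum>i\<in>I. m i x / pmf PX x)" by (rule sum.cong) auto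
    also have "\<dots> = 1" using I(4)[OF x] pos[OF x] by (simp add: sum_divide_distrib[symmetric])
    finally have "(\<integral>\<^sup>+ i. ennreal (?q i) \<partial>count_space UNIV) = 1" by simp
    then show ?thesis using nn by (intro exI[of _ "embed_pmf ?q"] allI pmf_embed_pmf) auto
  qed
  then obtain q where q: "\<And>x i. x \<in> F \<Longrightarrow> pmf (q x) i = (if i \<in> I then m i x / pmf PX x else 0)"
    by metis
  \<comment> \<open>Points outside \<open>F\<close> send the default index 0, which may also lie in
    \<open>I\<close>; the key map used below is therefore cut off to \<open>[]\<close> outside
    \<open>F\<close>.\<close>
  define GA where "GA = Pi_pmf F (0::nat) q"
  show ?thesis
  proof (rule one_way_achieves_atoms[of "\<lambda>w. if w \<in> I then F else {}" PX GA "\<lambda>x g. g x" m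
        "\<lambda>w x. if w \<in> I \<and> x \<in> F then f w x else []"])
    fix w x assume "x \<in> (if w \<in> I then F else {})"
    then have wx: "w \<in> I" "x \<in> F" by (auto split: if_splits)
    have "measure_pmf.prob GA {g. g x = w} = measure_pmf.prob (map_pmf (\<lambda>g. g x) GA) {w}"
      by (simp add: measure_map_pmf vimage_def)
    also have "\<dots> = pmf (q x) w"
      using wx F(1) by (simp add: GA_def Pi_pmf_component pmf.rep_eq)
    finally show "pmf PX x * measure_pmf.prob GA {g. g x = w} = m w x"
      using wx q pos[OF wx(2)] by simp
  next
    fix w
    show "balanced (if w \<in> I then F else {}) (m w) (\<lambda>x. if w \<in> I \<and> x \<in> F then f w x else [])"
      using I(3)[of w] by (auto simp: balanced_def cong: conj_cong)
  next
    have "ennreal l \<le> ennreal (\<Sum>i\<in>I. \<Sum>x\<in>F. m i x * real (length (f i x)))"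
      using I(5) by (rule ennreal_leI)
    also have "\<dots> = (\<Sum>i\<in>I. ennreal (\<Sum>x\<in>F. m i x * real (length (f i x))))"
      by (rule sum_ennreal[symmetric]) (auto intro!: sum_nonneg mult_nonneg_nonneg I(2))
    also have "\<dots> = (\<Sum>w\<in>I. ennreal (\<Sum>x\<in>(if w \<in> I then F else {}). m w x * real (length (if w \<in> I \<and> x \<in> F then f w x else []))))"
      by (rule sum.cong) auto
    also have "\<dots> \<le> (\<Sum>w. ennreal (\<Sum>x\<in>(if w \<in> I then F else {}). m w x * real (length (if w \<in> I \<and> x \<in> F then f w x else []))))"
      by (rule sum_le_suminf) (use I(1) in auto)
    finally show "ennreal l \<le> \<dots>" .
  qed (use F(1) in \<open>auto split: if_splits\<close>)
qed

section \<open>Dyadic level sets and laws of finite entropy\<close>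

definition pmf_level :: "'a pmf \<Rightarrow> 'a \<Rightarrow> nat" where
  "pmf_level p x = (LEAST n. (1/2) ^ n \<le> pmf p x)"

text \<open>Unlike \<open>level\<close>, \<open>pmf_level\<close> is single-valued, so these sets
  partition the support; they are indexed by the lower end of the interval. Off the support
  \<open>pmf_level\<close> is an arbitrary value, hence the restriction.\<close>

definition level_set :: "'a pmf \<Rightarrow> nat \<Rightarrow> 'a set" where
  "level_set p i = {x \<in> set_pmf p. pmf_level p x = i}"

lemma level_set_bounds:
  assumes "x \<in> level_set p i"
  shows "(1/2) ^ i \<le> pmf p x" "pmf p x \<le> 2 * (1/2) ^ i"
proof -
  have x: "0 < pmf p x" "i = (LEAST n. (1/2) ^ n \<le> pmf p x)"
    using assms by (auto simp: level_set_def pmf_level_def pmf_positive)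
  obtain n where "(1/2) ^ n < pmf p x" using real_arch_pow_inv[OF x(1), of "1/2"] by auto
  then have "(1/2) ^ n \<le> pmf p x" by simp
  then show "(1/2) ^ i \<le> pmf p x" unfolding x(2) by (rule LeastI)
  show "pmf p x \<le> 2 * (1/2) ^ i"
  proof (cases i)
    case 0 then show ?thesis using pmf_le_1[of p x] by simp
  next
    case (Suc j)
    then have "\<not> (1/2) ^ j \<le> pmf p x" using not_less_Least[of j "\<lambda>n. (1/2) ^ n \<le> pmf p x"] x(2) by simp
    then show ?thesis using Suc by simp
  qed
qed

text \<open>Each member has mass at least \<open>2^-i\<close>, so every finite subset has at most
  \<open>2^i\<close> elements.\<close>

lemma finite_level_set: "finite (level_set p i)"
proof -
  have "finite T \<and> card T \<le> 2 ^ i" if "finite T" "T \<subseteq> level_set p i" for T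
  proof -
    have "real (card T) * (1/2) ^ i = (\<Sum>x\<in>T. (1/2) ^ i)" by simp
    also have "\<dots> \<le> (\<Sum>x\<in>T. pmf p x)" by (rule sum_mono, rule level_set_bounds(1)) (use that in auto)
    also have "\<dots> = measure_pmf.prob p T" using that by (simp add: measure_measure_pmf_finite)
    also have "\<dots> \<le> 1" by simp
    finally have "real (card T) \<le> real (2 ^ i)" by (simp add: power_one_over field_simps)
    then show ?thesis using that(1) by (simp only: of_nat_le_iff)
  qed
  then show ?thesis by (metis finite_if_finite_subsets_card_bdd)
qed

lemma nn_integral_level_sets:
  fixes f :: "'a \<Rightarrow> ennreal"
  assumes "\<And>x. x \<notin> set_pmf p \<Longrightarrow> f x = 0"
  shows "(\<integral>\<^sup>+ x. f x \<partial>count_space UNIV) = (\<Sum>i. \<Sum>x\<in>level_set p i. f x)"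
proof -
  have "(\<integral>\<^sup>+ x. f x \<partial>count_space UNIV) = (\<integral>\<^sup>+ x. (\<Sum>i. if i = pmf_level p x then f x else 0) \<partial>count_space UNIV)"
    by (rule nn_integral_cong) (simp add: sums_unique[OF sums_single, symmetric])
  also have "\<dots> = (\<Sum>i. \<integral>\<^sup>+ x. (if i = pmf_level p x then f x else 0) \<partial>count_space UNIV)"
    by (rule nn_integral_suminf) simp
  also have "\<dots> = (\<Sum>i. \<Sum>x\<in>level_set p i. f x)"
  proof (rule suminf_cong)
    fix i
    have "(\<integral>\<^sup>+ x. (if i = pmf_level p x then f x else 0) \<partial>count_space UNIV)
        = (\<Sum>x\<in>level_set p i. if i = pmf_level p x then f x else 0)"
      by (rule nn_integral_count_space') (use assms finite_level_set in \<open>auto simp: level_set_def\<close>)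
    also have "\<dots> = (\<Sum>x\<in>level_set p i. f x)" by (rule sum.cong) (auto simp: level_set_def)
    finally show "(\<integral>\<^sup>+ x. (if i = pmf_level p x then f x else 0) \<partial>count_space UNIV) = (\<Sum>x\<in>level_set p i. f x)" .
  qed
  finally show ?thesis .
qed

text \<open>The first \<open>n\<close> level sets exhaust the support, so the sums converge to
  \<open>r\<close>. It is applied to the entropy terms and to the mass, so that one \<open>n\<close>
  serves both.\<close>

lemma eventually_level_sets_gt:
  fixes f :: "'a \<Rightarrow> real"
  assumes f: "\<And>x. 0 \<le> f x" "\<And>x. x \<notin> set_pmf p \<Longrightarrow> f x = 0"
    and r: "(\<integral>\<^sup>+ x. ennreal (f x) \<partial>count_space UNIV) = ennreal r" "c < r" "0 \<le> c"
  shows "eventually (\<lambda>n. c < sum f (\<Union>i<n. level_set p i)) sequentially"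
proof -
  have "(\<Sum>i. \<Sum>x\<in>level_set p i. ennreal (f x)) = ennreal r"
    using nn_integral_level_sets[of p "\<lambda>x. ennreal (f x)"] f r by simp
  then have "(\<lambda>n. \<Sum>i<n. \<Sum>x\<in>level_set p i. ennreal (f x)) \<longlonglongrightarrow> ennreal r"
    using summable_LIMSEQ[of "\<lambda>i. \<Sum>x\<in>level_set p i. ennreal (f x)"] by simp
  moreover have "(\<Sum>i<n. \<Sum>x\<in>level_set p i. ennreal (f x)) = ennreal (sum f (\<Union>i<n. level_set p i))" for n
  proof -
    have "(\<Sum>i<n. \<Sum>x\<in>level_set p i. ennreal (f x)) = (\<Sum>x\<in>(\<Union>i<n. level_set p i). ennreal (f x))"
      by (rule sum.UNION_disjoint[symmetric]) (use finite_level_set in \<open>auto simp: level_set_def\<close>)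
    then show ?thesis using f by (simp add: sum_ennreal)
  qed
  ultimately have "(\<lambda>n. ennreal (sum f (\<Union>i<n. level_set p i))) \<longlonglongrightarrow> ennreal r" by simp
  then have "eventually (\<lambda>n. ennreal c < ennreal (sum f (\<Union>i<n. level_set p i))) sequentially"
    by (rule order_tendstoD) (use r in \<open>simp add: ennreal_less_iff\<close>)
  then show ?thesis by (rule eventually_mono) (use r in \<open>simp add: ennreal_less_iff\<close>)
qed

lemma entropy_term_nonneg: "0 \<le> pmf p x * log 2 (1 / pmf p x)"
proof (cases "pmf p x = 0")
  case False
  then have "0 < pmf p x" by simp
  then show ?thesis using pmf_le_1[of p x] by (intro mult_nonneg_nonneg) (auto simp: zero_le_log_cancel_iff)
qed simp

text \<open>The budget of 2 bits: 3/2 from \<open>keyed_entropy\<close>, 1/4 of entropy in the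
  discarded tail, and 1/4 for \<open>P * log 2 P\<close>, which is at least
  \<open>- 3/2 * (1 - P)\<close> with \<open>P > 5/6\<close>.\<close>

lemma one_way_achieves_finite_entropy:
  fixes PX :: "'a pmf"
  assumes H: "entropy_pmf PX = ennreal r" "2 \<le> r"
  shows "one_way_achieves (map_pmf (\<lambda>x. (x, x)) PX) 0 (ennreal (r - 2))"
proof -
  let ?h = "\<lambda>x. pmf PX x * log 2 (1 / pmf PX x)"
  let ?F = "\<lambda>n. \<Union>i<n. level_set PX i"
  have "eventually (\<lambda>n. r - 1/4 < sum ?h (?F n)) sequentially"
    by (rule eventually_level_sets_gt[of _ _ r])
      (use H entropy_term_nonneg in \<open>auto simp: entropy_pmf_def set_pmf_iff\<close>)
  moreover have "eventually (\<lambda>n. 5/6 < sum (pmf PX) (?F n)) sequentially"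
    by (rule eventually_level_sets_gt[of _ _ 1]) (auto simp: nn_integral_pmf set_pmf_iff)
  ultimately have "eventually (\<lambda>n. r - 1/4 < sum ?h (?F n) \<and> 5/6 < sum (pmf PX) (?F n)) sequentially"
    by (rule eventually_conj)
  then obtain n where n: "r - 1/4 < sum ?h (?F n)" "5/6 < sum (pmf PX) (?F n)"
    by (auto simp: eventually_sequentially)
  define F where "F = ?F n"
  define P where "P = sum (pmf PX) F"
  have F: "finite F" "F \<subseteq> set_pmf PX" using finite_level_set by (auto simp: F_def level_set_def)
  have P: "5/6 < P" "P \<le> 1"
    using n(2) F(1) measure_pmf.prob_le_1[of PX F] by (auto simp: P_def F_def[symmetric] measure_measure_pmf_finite)
  have "keyed F (pmf PX) (sum ?h F + P * log 2 P - 3 / 2 * P)"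
    by (rule keyed_entropy) (use F P in \<open>auto simp: P_def pmf_positive\<close>)
  then have 1: "one_way_achieves (map_pmf (\<lambda>x. (x, x)) PX) 0 (ennreal (sum ?h F + P * log 2 P - 3 / 2 * P))"
    by (rule one_way_achieves_keyed[OF F])
  have "log 2 (1 / P) = ln (1 / P) / ln 2" by (simp add: log_def)
  also have "\<dots> \<le> (1 / P - 1) / (2/3)"
    by (rule frac_le) (use P ln_le_minus_one[of "1 / P"] ln2_ge_two_thirds in \<open>auto simp: field_simps\<close>)
  finally have "P * log 2 (1 / P) \<le> P * ((1 / P - 1) / (2/3))" using P by (intro mult_left_mono) auto
  also have "\<dots> = 3/2 * (1 - P)" using P by (simp add: field_simps)
  finally have "- (1/4) \<le> P * log 2 P" using P by (simp add: log_divide)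
  then have "r - 2 \<le> sum ?h F + P * log 2 P - 3 / 2 * P"
    using n(1) P(2) unfolding F_def[symmetric] by linarith
  then show ?thesis by (intro one_way_achieves_mono[OF 1] ennreal_leI)
qed

section \<open>Laws of infinite entropy\<close>

lemma balanced_uniform:
  assumes b: "bij_betw f T {l. length l = n}"
  shows "balanced T (\<lambda>_. a) f"
proof -
  have *: "card {x \<in> T. prefix u (f x)} = card {l. length l = n \<and> prefix u l}" for u
  proof (rule bij_betw_same_card[of f])
    have "f ` {x \<in> T. prefix u (f x)} = {l. length l = n \<and> prefix u l}"
      using b by (auto simp: bij_betw_def)
    moreover have "inj_on f {x \<in> T. prefix u (f x)}"
      using b by (auto simp: bij_betw_def intro: inj_on_subset)
    ultimately show "bij_betw f {x \<in> T. prefix u (f x)} {l. length l = n \<and> prefix u l}"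
      by (simp add: bij_betw_def)
  qed
  have "card {l. length l = n \<and> prefix (v @ [False]) l} = card {l. length l = n \<and> prefix (v @ [True]) l}" for v
  proof (rule bij_betw_same_card)
    \<comment> \<open>Flipping the bit after \<open>v\<close> exchanges the two families of
      strings.\<close>
    show "bij_betw (\<lambda>l. l[length v := True]) {l. length l = n \<and> prefix (v @ [False]) l} {l. length l = n \<and> prefix (v @ [True]) l}"
      by (rule bij_betw_byWitness[where f' = "\<lambda>l. l[length v := False]"])
        (auto simp: prefix_snoc_iff_nth take_update_cancel list_update_same_conv)
  qed
  then show ?thesis by (simp add: balanced_def *)
qed

text \<open>One fixed variable realises every acceptance probability, so it can thin all points at
  once.\<close>

lemma geometric_pmf_half_realises:
  assumes "0 \<le> \<alpha>" "\<alpha> \<le> 1"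
  shows "\<exists>S. measure_pmf.prob (geometric_pmf (1/2)) S = \<alpha>"
proof (cases "\<alpha> = 1")
  case True
  then show ?thesis by (intro exI[of _ UNIV]) simp
next
  case False
  \<comment> \<open>\<open>S\<close> collects the positions of the ones in the binary expansion of \<open>\<alpha>\<close>.\<close>
  define d where "d n = \<lfloor>\<alpha> * 2 ^ n\<rfloor>" for n
  define S where "S = {g. odd (d (Suc g))}"
  have step: "d (Suc n) = 2 * d n + (if n \<in> S then 1 else 0)" for n
  proof -
    have "of_int (2 * d n) \<le> \<alpha> * 2 ^ Suc n" "\<alpha> * 2 ^ Suc n < of_int (2 * d n + 2)"
    proof -
      have "of_int (d n) \<le> \<alpha> * 2 ^ n" "\<alpha> * 2 ^ n < of_int (d n) + 1" unfolding d_def by linarith+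
      then show "of_int (2 * d n) \<le> \<alpha> * 2 ^ Suc n" "\<alpha> * 2 ^ Suc n < of_int (2 * d n + 2)" by simp_all
    qed
    then have "2 * d n \<le> d (Suc n)" "d (Suc n) < 2 * d n + 2"
      unfolding d_def[of "Suc n"] by (simp_all only: le_floor_iff floor_less_iff)
    then have "d (Suc n) = 2 * d n \<or> d (Suc n) = 2 * d n + 1" by linarith
    then show ?thesis by (auto simp: S_def)
  qed
  \<comment> \<open>\<open>D n\<close> is the truncation of \<open>\<alpha>\<close> to
    \<open>n\<close> binary digits.\<close>
  define D :: "nat \<Rightarrow> real" where "D n = of_int (d n) / 2 ^ n" for n
  have D: "D (Suc n) - D n = (if n \<in> S then (1/2) ^ Suc n else 0)" for n
    unfolding D_def step by (auto simp: field_simps power_one_over)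
  have lim: "D \<longlonglongrightarrow> \<alpha>"
  proof (rule tendsto_sandwich[of "\<lambda>n. \<alpha> - (1/2) ^ n" _ _ "\<lambda>n. \<alpha>"])
    show "eventually (\<lambda>n. \<alpha> - (1/2) ^ n \<le> D n) sequentially"
    proof (rule always_eventually, rule allI)
      fix n
      have "\<alpha> * 2 ^ n - 1 \<le> of_int (d n)" unfolding d_def by linarith
      then have "(\<alpha> * 2 ^ n - 1) / 2 ^ n \<le> D n" unfolding D_def by (intro divide_right_mono) auto
      then show "\<alpha> - (1/2) ^ n \<le> D n" by (simp add: diff_divide_distrib power_one_over)
    qed
    show "eventually (\<lambda>n. D n \<le> \<alpha>) sequentially"
    proof (rule always_eventually, rule allI)
      fix n
      have "of_int (d n) \<le> \<alpha> * 2 ^ n" unfolding d_def by linarith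
      then have "D n \<le> \<alpha> * 2 ^ n / 2 ^ n" unfolding D_def by (intro divide_right_mono) auto
      then show "D n \<le> \<alpha>" by simp
    qed
    have "(\<lambda>n. \<alpha> - (1/2) ^ n) \<longlonglongrightarrow> \<alpha> - 0"
      by (intro tendsto_intros LIMSEQ_power_zero) simp
    then show "(\<lambda>n. \<alpha> - (1/2) ^ n) \<longlonglongrightarrow> \<alpha>" by simp
  qed simp
  \<comment> \<open>The telescoped sum is \<open>\<alpha> - D 0\<close>; at
    \<open>\<alpha> = 1\<close> the floor would be 1, which is why that case was split off.\<close>
  have "D 0 = 0" using assms False by (simp add: D_def d_def floor_eq_iff)
  then have sums: "(\<lambda>n. if n \<in> S then (1/2) ^ Suc n else 0) sums \<alpha>"
    using telescope_sums[OF lim] unfolding D by simp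
  have "emeasure (measure_pmf (geometric_pmf (1/2))) S = (\<integral>\<^sup>+ g. ennreal (pmf (geometric_pmf (1/2)) g) * indicator S g \<partial>count_space UNIV)"
    by (simp add: nn_integral_pmf[symmetric] nn_integral_count_space_indicator)
  also have "\<dots> = (\<Sum>g. ennreal (pmf (geometric_pmf (1/2)) g) * indicator S g)"
    by (rule nn_integral_count_space_nat)
  also have "\<dots> = (\<Sum>g. ennreal (if g \<in> S then (1/2) ^ Suc g else 0))"
    by (rule suminf_cong) (simp add: indicator_def mult.commute)
  also have "\<dots> = ennreal \<alpha>"
    by (rule suminf_ennreal_eq) (use sums in auto)
  finally show ?thesis
    using assms by (intro exI[of _ S]) (simp add: measure_def)
qed

text \<open>At most \<open>2 * 2^k\<close> points of mass at most \<open>2 * 2^-i\<close> contribute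
  at most \<open>i\<close> bits each. If \<open>i \<le> 2 * k\<close>, this is bounded by the key
  length of the level; otherwise \<open>2^k * 2^-i\<close> is below the geometric
  \<open>(sqrt 2 / 2)^i\<close>. The factor \<open>Suc i\<close> matches
  \<open>geometric_deriv_sums\<close>.\<close>

lemma entropy_level_set_le:
  assumes "card (level_set p i) < 2 ^ Suc k"
  shows "(\<Sum>x\<in>level_set p i. pmf p x * log 2 (1 / pmf p x))
    \<le> 8 * (2 ^ k * (1/2) ^ i * real k) + 4 * (real (Suc i) * (sqrt 2 / 2) ^ i)"
proof -
  have "(\<Sum>x\<in>level_set p i. pmf p x * log 2 (1 / pmf p x)) \<le> (\<Sum>x\<in>level_set p i. 2 * (1/2) ^ i * real i)"
  proof (rule sum_mono)
    fix x assume x: "x \<in> level_set p i"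
    have pos: "0 < pmf p x" using x by (auto simp: level_set_def pmf_positive)
    have "1 / pmf p x \<le> 2 ^ i"
      using level_set_bounds(1)[OF x] pos by (simp add: power_one_over field_simps)
    then have "log 2 (1 / pmf p x) \<le> log 2 (2 ^ i)" using pos by (subst log_le_cancel_iff) auto
    then have "log 2 (1 / pmf p x) \<le> real i" by (simp add: log_nat_power)
    moreover have "0 \<le> log 2 (1 / pmf p x)" using pos pmf_le_1[of p x] by (simp add: zero_le_log_cancel_iff)
    ultimately show "pmf p x * log 2 (1 / pmf p x) \<le> 2 * (1/2) ^ i * real i"
      using level_set_bounds(2)[OF x] by (intro mult_mono) auto
  qed
  also have "\<dots> = real (card (level_set p i)) * (2 * (1/2) ^ i * real i)" by simp
  also have "\<dots> \<le> real (2 ^ Suc k) * (2 * (1/2) ^ i * real i)"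
    using assms by (intro mult_right_mono) (simp_all only: of_nat_le_iff less_imp_le, simp)
  also have "\<dots> = 4 * (2 ^ k * (1/2) ^ i * real i)" by simp
  also have "\<dots> \<le> 8 * (2 ^ k * (1/2) ^ i * real k) + 4 * (real (Suc i) * (sqrt 2 / 2) ^ i)"
  proof (cases "i \<le> 2 * k")
    case True
    then have "2 ^ k * (1/2) ^ i * real i \<le> 2 ^ k * (1/2) ^ i * (2 * real k)"
      by (intro mult_left_mono) auto
    moreover have "0 \<le> real (Suc i) * (sqrt 2 / 2) ^ i" by simp
    ultimately show ?thesis by linarith
  next
    case False
    have "(2 :: real) ^ k = sqrt 2 ^ (2 * k)" by (simp add: power_mult)
    also have "\<dots> \<le> sqrt 2 ^ i" using False by (intro power_increasing) auto
    finally have "2 ^ k * (1/2) ^ i \<le> sqrt 2 ^ i * (1/2 :: real) ^ i" by (intro mult_right_mono) auto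
    then have "2 ^ k * (1/2) ^ i \<le> (sqrt 2 / 2) ^ i" by (simp add: power_mult_distrib[symmetric])
    then have "2 ^ k * (1/2) ^ i * real i \<le> (sqrt 2 / 2) ^ i * real (Suc i)"
      by (intro mult_mono) auto
    moreover have "0 \<le> 2 ^ k * (1/2 :: real) ^ i * real k" by simp
    ultimately show ?thesis by (simp only: mult.commute[of "(sqrt 2 / 2) ^ i"])
  qed
  finally show ?thesis .
qed

text \<open>The local randomness is countable, so independent kernels for infinitely many points
  are not available; binary thinning from a geometric variable is all that is needed here.\<close>

lemma one_way_achieves_infinite_entropy:
  fixes PX :: "'a pmf"
  assumes H: "entropy_pmf PX = \<infinity>"
  shows "one_way_achieves (map_pmf (\<lambda>x. (x, x)) PX) 0 \<infinity>"
proof -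
  let ?D = "level_set PX"
  \<comment> \<open>\<open>2^k\<close> is the largest power of two not exceeding the size of the
    level set, and \<open>T\<close> holds that many points, in bijection with the strings of length
    \<open>k\<close>. An empty level set gets \<open>k = 0\<close> and
    \<open>T = {}\<close>.\<close>
  have "\<exists>k T f. T \<subseteq> ?D i \<and> card (?D i) < 2 ^ Suc k \<and> balanced T (\<lambda>_. (1/2) ^ i) f \<and>
      (\<forall>x. x \<notin> T \<longrightarrow> f x = []) \<and>
      (\<Sum>x\<in>T. (1/2) ^ i * real (length (f x))) = 2 ^ k * (1/2) ^ i * real k" for i
  proof (cases "?D i = {}")
    case True
    show ?thesis
      by (rule exI[of _ 0], rule exI[of _ "{}"], rule exI[of _ "\<lambda>_. []"]) (simp add: True balanced_Nil)
  next
    case False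
    then have "1 \<le> card (?D i)" using finite_level_set[of PX i] by (simp add: Suc_le_eq card_gt_0_iff)
    then obtain k where k: "2 ^ k \<le> card (?D i)" "card (?D i) < 2 ^ (k + 1)"
      using ex_power_ivl1[of 2 "card (?D i)"] by auto
    obtain T where T: "T \<subseteq> ?D i" "card T = 2 ^ k" "finite T"
      using obtain_subset_with_card_n[OF k(1)] by auto
    have "card {l :: bool list. length l = k} = 2 ^ k" "finite {l :: bool list. length l = k}"
      using card_lists_length_eq[of "UNIV :: bool set" k] finite_lists_length_eq[of "UNIV :: bool set" k]
      by (simp_all add: card_UNIV_bool)
    then obtain b where b: "bij_betw b T {l :: bool list. length l = k}"
      using finite_same_card_bij[of T "{l :: bool list. length l = k}"] T by auto
    define f where "f x = (if x \<in> T then b x else [])" for x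
    have bf: "bij_betw f T {l :: bool list. length l = k}"
      using b by (subst bij_betw_cong[of T f b]) (auto simp: f_def)
    have "(\<Sum>x\<in>T. (1/2) ^ i * real (length (f x))) = (\<Sum>x\<in>T. (1/2) ^ i * real k)"
      by (rule sum.cong) (use bf in \<open>auto simp: bij_betw_def\<close>)
    then show ?thesis
      by (intro exI[of _ k] exI[of _ T] exI[of _ f])
        (use T k balanced_uniform[OF bf] in \<open>auto simp: f_def\<close>)
  qed
  then obtain k T f where T: "\<And>i. T i \<subseteq> ?D i" and k: "\<And>i. card (?D i) < 2 ^ Suc (k i)"
    and bal: "\<And>i. balanced (T i) (\<lambda>_. (1/2) ^ i) (f i)" and nil: "\<And>i x. x \<notin> T i \<Longrightarrow> f i x = []"
    and len: "\<And>i. (\<Sum>x\<in>T i. (1/2) ^ i * real (length (f i x))) = 2 ^ k i * (1/2) ^ i * real (k i)"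
    by metis
  have "\<exists>S. measure_pmf.prob (geometric_pmf (1/2)) S = (1/2) ^ pmf_level PX x / pmf PX x" if "x \<in> set_pmf PX" for x
    by (rule geometric_pmf_half_realises)
      (use that level_set_bounds(1)[of x PX "pmf_level PX x"] in \<open>auto simp: level_set_def pmf_positive\<close>)
  then obtain S where S: "\<And>x. x \<in> set_pmf PX \<Longrightarrow>
      measure_pmf.prob (geometric_pmf (1/2)) (S x) = (1/2) ^ pmf_level PX x / pmf PX x"
    by metis
  let ?g = "\<lambda>i. 2 ^ k i * (1/2) ^ i * real (k i)"
  let ?z = "\<lambda>i. real (Suc i) * (sqrt 2 / 2) ^ i"
  \<comment> \<open>If the key lengths had a finite sum, the level-wise bound would make the entropy
    finite, since \<open>?z\<close> is summable.\<close>
  have top: "(\<Sum>i. ennreal (?g i)) = \<infinity>"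
  proof (rule ccontr)
    assume fin: "(\<Sum>i. ennreal (?g i)) \<noteq> \<infinity>"
    have "norm (sqrt 2 / 2 :: real) < 1" using sqrt2_less_2 by simp
    then have "summable ?z" using geometric_deriv_sums sums_summable by blast
    then have z: "(\<Sum>i. ennreal (?z i)) \<noteq> \<infinity>"
      unfolding infinity_ennreal_def by (rule ennreal_suminf_neq_top) (rule mult_nonneg_nonneg, auto)
    have "entropy_pmf PX = (\<Sum>i. \<Sum>x\<in>?D i. ennreal (pmf PX x * log 2 (1 / pmf PX x)))"
      unfolding entropy_pmf_def by (rule nn_integral_level_sets) (simp add: set_pmf_iff)
    also have "\<dots> = (\<Sum>i. ennreal (\<Sum>x\<in>?D i. pmf PX x * log 2 (1 / pmf PX x)))"
      by (simp only: sum_ennreal[OF entropy_term_nonneg])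
    also have "\<dots> \<le> (\<Sum>i. ennreal (8 * ?g i + 4 * ?z i))"
      by (intro suminf_le ennreal_leI entropy_level_set_le k) auto
    also have "\<dots> = (\<Sum>i. 8 * ennreal (?g i) + 4 * ennreal (?z i))"
      by (rule suminf_cong) (simp add: ennreal_plus ennreal_mult')
    also have "\<dots> = 8 * (\<Sum>i. ennreal (?g i)) + 4 * (\<Sum>i. ennreal (?z i))"
      by (simp add: suminf_add[symmetric])
    also have "\<dots> < \<infinity>" using fin z by (simp add: ennreal_mult_less_top less_top)
    finally show False using H by simp
  qed
  show ?thesis
  \<comment> \<open>A rejected point announces the level after its own. It does not belong to that
    level set, so its key is empty and the atom there is undisturbed.\<close>
  proof (rule one_way_achieves_atoms[of T PX "geometric_pmf (1/2)"
        "\<lambda>x g. if g \<in> S x then pmf_level PX x else Suc (pmf_level PX x)" "\<lambda>i _. (1/2) ^ i" f])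
    fix i x assume x: "x \<in> T i"
    then have "x \<in> set_pmf PX" "pmf_level PX x = i" using T[of i] by (auto simp: level_set_def)
    moreover have "{g. (if g \<in> S x then pmf_level PX x else Suc (pmf_level PX x)) = i} = S x"
      using \<open>pmf_level PX x = i\<close> by auto
    ultimately show "pmf PX x * measure_pmf.prob (geometric_pmf (1/2))
        {g. (if g \<in> S x then pmf_level PX x else Suc (pmf_level PX x)) = i} = (1/2) ^ i"
      using S[of x] pmf_positive[of x PX] by (simp add: set_pmf_iff)
  next
    show "finite (T i)" for i using T finite_level_set by (rule finite_subset)
  qed (use bal nil top in \<open>auto simp: len\<close>)
qed

theorem theorem1:
  fixes PX :: "'a pmf"
  shows "one_way_achieves (map_pmf (\<lambda>x. (x, x)) PX) 0 (entropy_pmf PX - 2)"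
proof (cases "entropy_pmf PX")
  case (real r)
  show ?thesis
  proof (cases "2 \<le> r")
    case True
    then show ?thesis
      using one_way_achieves_finite_entropy[OF real(2) True] real ennreal_minus[of 2 r] by simp
  next
    case False
    \<comment> \<open>Below 2 bits the truncated difference in \<open>ennreal\<close> is 0, and a
      scheme with empty keys is enough.\<close>
    have "keyed {} (pmf PX) 0" by (rule keyed_0) simp
    then have "one_way_achieves (map_pmf (\<lambda>x. (x, x)) PX) 0 (ennreal 0)"
      by (intro one_way_achieves_keyed[of "{}"]) auto
    moreover have "entropy_pmf PX - 2 = 0"
      using False real ennreal_minus[of 2 r] by (simp add: ennreal_neg)
    ultimately show ?thesis by simp
  qed
next
  case top
  then show ?thesis using one_way_achieves_infinite_entropy[of PX] by simp
qed

end
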